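(* Let $N>r\ge 1$ and $n\ge 1$ be integers, let $A\in\mathbb{R}^{N\times r}$ with $\operatorname{rank}(A)=r$, and let $B\in\mathbb{R}^{N\times n}$. Let $p\in[0,1]^N$ be a probability distribution and assume there exists a fixed $\beta\in(0,1]$ such that $p_i\ge\beta\,\ell_i(A)/r$ for all $i\in[N]$. Let $\mathcal{D}\subset[N]$ be a deterministic index set with $d=|\mathcal{D}|$ elements, and let $p_{\det}=\sum_{i\in\mathcal{D}}p_i$, with $p_{\det}<1$. For any $\varepsilon,\delta\in(0,1)$, set $s=d+\tilde s$ with $$\tilde s=\left\lceil(1-p_{\det})\,\frac{r}{\beta}\,\max\left\{2C\ln(2r/\delta),\ \frac{4}{\delta\varepsilon}\right\}\right\rceil,\qquad C=\frac{\sqrt2}{\sqrt2-1-\log(2)/2}\approx 20.9080 .$$ Let $S\sim\mathrm{HybridSample}(s,p,\mathcal{D})$. Let $X_{\mathrm{opt}}=\arg\min_{X\in\mathbb{R}^{r\times n}}\|AX-B\|_F^2$ and let $\widetilde X_{\mathrm{opt}}$ be a minimizer of $\|SAX-SB\|_F^2$ over $X\in\mathbb{R}^{r\times n}$. Then, with probability at least $1-\delta$, $$\|A\widetilde X_{\mathrm{opt}}-B\|_F^2\le(1+\varepsilon)\,\|AX_{\mathrm{opt}}-B\|_F^2 .$$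
   Context: $[N]=\{1,\dots,N\}$; $\log=\ln$ is the natural logarithm; $\|\cdot\|_F$ is the Frobenius norm. A vector $p\in[0,1]^N$ is a probability distribution if $\sum_{i=1}^N p_i=1$. Leverage scores: for $A\in\mathbb{R}^{N\times r}$ of rank $r$, let $U_A\in\mathbb{R}^{N\times r}$ be any matrix whose columns form an orthonormal basis of the column space of $A$; then $\ell_i(A)=\|U_A(i,:)\|_2^2$ for $i\in[N]$ (independent of the choice of basis). HybridSample: let $\mathcal{D}\subset[N]$ be an (ordered) index set with $d=|\mathcal{D}|$ and $p_{\det}=\sum_{i\in\mathcal{D}}p_i<1$. $S\in\mathbb{R}^{s\times N}\sim\mathrm{HybridSample}(s,p,\mathcal{D})$ means $S=\begin{bmatrix}D\\ \widetilde S\end{bmatrix}$ with $D\in\mathbb{R}^{d\times N}$ and $\widetilde S\in\mathbb{R}^{\tilde s\times N}$, $\tilde s=s-d$. The $j$th row of $D$ is the unit vector $e_{k_j}^{\top}$, where $k_j$ is the $j$th element of $\mathcal{D}$. For $\widetilde S$: let $\tilde p_i=p_i/(1-p_{\det})$ for $i\in[N]\setminus\mathcal{D}$ and $\tilde p_i=0$ for $i\in\mathcal{D}$; draw independent $\xi^{(1)},\dots,\xi^{(\tilde s)}$ with $\Pr(\xi^{(j)}=i)=\tilde p_i$; then $\widetilde S(j,i)=1/\sqrt{\tilde s\,\tilde p_i}$ if $\xi^{(j)}=i$ and $0$ otherwise. *)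

theory Defs
  imports "HOL-Probability.Probability" "Jordan_Normal_Form.DL_Rank" "Jordan_Normal_Form.Gram_Schmidt"
begin

text \<open>Vectors and matrices are those of \<^theory>\<open>Jordan_Normal_Form.Matrix\<close>, since the number of
  rows of the sketching matrix is computed from real parameters. They are indexed from 0, so the
  index set \<open>[N]\<close> is \<open>{..<N}\<close>.\<close>

unbundle no vec_syntax
unbundle no inner_syntax

definition frobenius_norm :: "real mat \<Rightarrow> real" where
  "frobenius_norm A = sqrt (\<Sum>i<dim_row A. \<Sum>j<dim_col A. (A $$ (i, j))\<^sup>2)"

definition prob_vec :: "real Matrix.vec \<Rightarrow> bool" where
  "prob_vec p \<longleftrightarrow> (\<forall>i<dim_vec p. 0 \<le> p $ i \<and> p $ i \<le> 1) \<and> (\<Sum>i<dim_vec p. p $ i) = 1"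

subsection \<open>Leverage scores\<close>

definition orthonormal_basis_mat :: "real mat \<Rightarrow> real mat \<Rightarrow> bool" where
  "orthonormal_basis_mat A U \<longleftrightarrow>
     U \<in> carrier_mat (dim_row A) (dim_col A) \<and>
     (\<forall>i<dim_col U. \<forall>j<dim_col U. col U i \<bullet> col U j = (if i = j then 1 else 0)) \<and>
     vec_space.col_space (dim_row A) U = vec_space.col_space (dim_row A) A"

text \<open>Meaningful for matrices of full column rank: such a \<open>U\<close> then exists
  (\<open>orthonormal_basis_mat_exists\<close>) and the score does not depend on its choice
  (\<open>leverage_score_eq\<close>).\<close>

definition leverage_score :: "real mat \<Rightarrow> nat \<Rightarrow> real" where
  "leverage_score A i =
     (let U = (SOME U. orthonormal_basis_mat A U) in \<Sum>k<dim_col U. (U $$ (i, k))\<^sup>2)"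

lemma col_space_mat_mult:
  fixes U V :: "real mat"
  assumes U: "U \<in> carrier_mat N r" and V: "V \<in> carrier_mat N r"
    and sub: "vec_space.col_space N U \<subseteq> vec_space.col_space N V"
  shows "\<exists>R \<in> carrier_mat r r. U = V * R"
proof -
  interpret vec_space "TYPE(real)" N .
  have "\<exists>x\<in>carrier_vec r. V *\<^sub>v x = col U j" if "j < r" for j
  proof -
    have "col U j \<in> set (cols U)" using that U by (auto simp: cols_def)
    moreover have "set (cols U) \<subseteq> carrier_vec N" using U cols_dim by blast
    ultimately have "col U j \<in> col_space U" unfolding col_space_def using span_mem by blast
    then show ?thesis using sub V col_space_eq[OF V] by auto
  qed
  then obtain x where x: "\<And>j. j < r \<Longrightarrow> x j \<in> carrier_vec r \<and> V *\<^sub>v x j = col U j" by metis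
  define R where "R = mat_of_cols r (map x [0..<r])"
  have R: "R \<in> carrier_mat r r" unfolding R_def by auto
  have "U = V * R"
  proof (rule mat_col_eqI)
    fix j assume "j < dim_col (V * R)"
    then have j: "j < r" using R by auto
    have "col R j = x j" unfolding R_def using x[OF j] j by (subst col_mat_of_cols) auto
    then show "col U j = col (V * R) j" using col_mult2[OF V R j] x[OF j] by simp
  qed (use U V R in auto)
  then show ?thesis using R by blast
qed

lemma orthonormal_basis_mat_proj:
  assumes U: "orthonormal_basis_mat A U" and V: "orthonormal_basis_mat A V"
  shows "U * U\<^sup>T = V * V\<^sup>T"
proof -
  have orth: "W\<^sup>T * W = 1\<^sub>m (dim_col A)" if "orthonormal_basis_mat A W" for W
    using that unfolding orthonormal_basis_mat_def by (intro eq_matI) auto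
  have fix_left: "W * W\<^sup>T * (Z * Z\<^sup>T) = Z * Z\<^sup>T"
    if W: "orthonormal_basis_mat A W" and Z: "orthonormal_basis_mat A Z" for W Z
  proof -
    let ?N = "dim_row A" and ?r = "dim_col A"
    have Wc: "W \<in> carrier_mat ?N ?r" and Zc: "Z \<in> carrier_mat ?N ?r"
      using W Z unfolding orthonormal_basis_mat_def by auto
    obtain R where R: "R \<in> carrier_mat ?r ?r" and ZR: "Z = W * R"
      using col_space_mat_mult[OF Zc Wc] W Z unfolding orthonormal_basis_mat_def by auto
    have Wt: "W\<^sup>T \<in> carrier_mat ?r ?N" and Zt: "Z\<^sup>T \<in> carrier_mat ?r ?N" using Wc Zc by auto
    have WtZ: "W\<^sup>T * Z = R"
    proof -
      have "W\<^sup>T * Z = W\<^sup>T * W * R" unfolding ZR by (rule assoc_mult_mat[OF Wt Wc R, symmetric])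
      then show ?thesis using orth[OF W] R by simp
    qed
    have "W * W\<^sup>T * Z = W * (W\<^sup>T * Z)" by (rule assoc_mult_mat[OF Wc Wt Zc])
    then have "W * W\<^sup>T * Z = Z" using WtZ ZR by simp
    moreover have "W * W\<^sup>T * (Z * Z\<^sup>T) = W * W\<^sup>T * Z * Z\<^sup>T"
      by (rule assoc_mult_mat[symmetric, OF _ Zc Zt]) (use Wc Wt in auto)
    ultimately show ?thesis by simp
  qed
  have sym: "(W * W\<^sup>T)\<^sup>T = W * W\<^sup>T" for W :: "real mat"
    by (subst transpose_mult[of _ "dim_row W" "dim_col W"]) auto
  have Uc: "U * U\<^sup>T \<in> carrier_mat (dim_row A) (dim_row A)"
   and Vc: "V * V\<^sup>T \<in> carrier_mat (dim_row A) (dim_row A)"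
    using U V unfolding orthonormal_basis_mat_def by auto
  have "U * U\<^sup>T = (V * V\<^sup>T * (U * U\<^sup>T))\<^sup>T" using fix_left[OF V U] sym by simp
  also have "\<dots> = U * U\<^sup>T * (V * V\<^sup>T)" using transpose_mult[OF Vc Uc] sym by simp
  also have "\<dots> = V * V\<^sup>T" by (rule fix_left[OF U V])
  finally show ?thesis .
qed

lemma leverage_score_eq:
  assumes U: "orthonormal_basis_mat A U" and i: "i < dim_row A"
  shows "leverage_score A i = (\<Sum>k<dim_col U. (U $$ (i, k))\<^sup>2)"
proof -
  define V where "V = (SOME V. orthonormal_basis_mat A V)"
  have V: "orthonormal_basis_mat A V" unfolding V_def using U by (rule someI)
  have diag: "(W * W\<^sup>T) $$ (i, i) = (\<Sum>k<dim_col W. (W $$ (i, k))\<^sup>2)"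
    if "orthonormal_basis_mat A W" for W
    using that i unfolding orthonormal_basis_mat_def
    by (auto simp: scalar_prod_def power2_eq_square atLeast0LessThan)
  show ?thesis
    using orthonormal_basis_mat_proj[OF U V] diag[OF U] diag[OF V]
    unfolding leverage_score_def V_def[symmetric] by simp
qed

lemma orthonormal_basis_mat_exists:
  assumes A: "A \<in> carrier_mat N r" and rank: "vec_space.rank N A = r"
  shows "\<exists>U. orthonormal_basis_mat A U"
proof -
  interpret cof_vec_space N "TYPE(real)" .
  have Ac: "set (cols A) \<subseteq> carrier_vec N" using A cols_dim by blast
  have "rank A \<le> card (set (cols A))"
  proof -
    obtain S where S: "maximal S (\<lambda>T. T \<subseteq> set (cols A) \<and> lin_indpt T)"
      using maximal_exists[of "\<lambda>T. T \<subseteq> set (cols A) \<and> lin_indpt T" "card (set (cols A))" "{}"]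
      by (meson List.finite_set card_mono empty_iff empty_subsetI finite_lin_indpt2 rev_finite_subset)
    then have "card S \<le> card (set (cols A))" by (simp add: card_mono maximal_def)
    then show ?thesis using rank_card_indpt[OF A S] by simp
  qed
  then have dist: "distinct (cols A)"
    using rank A card_length[of "cols A"] by (intro card_distinct) auto
  have ind: "lin_indpt (set (cols A))" by (rule full_rank_lin_indpt[OF A rank dist])
  define us where "us = gram_schmidt N (cols A)"
  note gs = gram_schmidt_result[OF Ac dist ind us_def]
  have len: "length us = r" using gs(4) A by simp
  define c where "c j = 1 / sqrt (us ! j \<bullet> us ! j)" for j
  define U where "U = mat_of_cols N (map (\<lambda>j. c j \<cdot>\<^sub>v us ! j) [0..<r])"
  have usc: "us ! j \<in> carrier_vec N" if "j < r" for j using gs(3) len that nth_mem by blast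
  have Uc: "U \<in> carrier_mat N r" unfolding U_def by auto
  have colU: "col U j = c j \<cdot>\<^sub>v us ! j" if "j < r" for j
    unfolding U_def using that usc by (subst col_mat_of_cols) auto
  have orth: "us ! i \<bullet> us ! j = 0 \<longleftrightarrow> i \<noteq> j" if "i < r" "j < r" for i j
    using gs(2) that len unfolding corthogonal_def by auto
  have pos: "us ! j \<bullet> us ! j > 0" if "j < r" for j
  proof -
    have "us ! j \<bullet> us ! j \<ge> 0" by (auto simp: scalar_prod_def intro: sum_nonneg)
    then show ?thesis using orth[OF that that] by linarith
  qed
  have "col U i \<bullet> col U j = (if i = j then 1 else 0)" if "i < r" "j < r" for i j
  proof -
    have "col U i \<bullet> col U j = c i * c j * (us ! i \<bullet> us ! j)"
      using usc[OF that(1)] usc[OF that(2)] colU that by simp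
    then show ?thesis using orth[OF that] pos[OF that(2)]
      by (auto simp: c_def real_sqrt_mult_self)
  qed
  moreover have "col_space U = col_space A"
  proof -
    have setU: "set (cols U) \<subseteq> carrier_vec N" using Uc cols_dim by blast
    have "set (cols U) \<subseteq> span (set us)"
    proof
      fix v assume "v \<in> set (cols U)"
      then obtain j where j: "j < r" "v = col U j" using Uc by (auto simp: cols_def)
      have "us ! j \<in> span (set us)" using gs(3) j len by (intro span_mem) auto
      then show "v \<in> span (set us)" unfolding j(2) colU[OF j(1)]
        by (rule smult_in_span[OF gs(3)])
    qed
    moreover have "set us \<subseteq> span (set (cols U))"
    proof
      fix v assume "v \<in> set us"
      then obtain j where j: "j < r" "v = us ! j" using len by (metis in_set_conv_nth)
      have "col U j \<in> span (set (cols U))" using setU j Uc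
        by (intro span_mem) (auto simp: cols_def)
      then have "(1 / c j) \<cdot>\<^sub>v col U j \<in> span (set (cols U))"
        by (rule smult_in_span[OF setU])
      moreover have "c j \<noteq> 0" using pos[OF j(1)] by (simp add: c_def)
      ultimately show "v \<in> span (set (cols U))" unfolding j(2) colU[OF j(1)]
        by (simp add: smult_smult_assoc)
    qed
    ultimately show ?thesis unfolding col_space_def gs(1)
      by (intro subset_antisym span_subsetI gs(3) setU)
  qed
  ultimately show ?thesis unfolding orthonormal_basis_mat_def using A Uc by auto
qed

subsection \<open>Hybrid sampling\<close>

text \<open>The ordered index set is given as a distinct list \<open>ks\<close>, its \<open>j\<close>th element being \<open>ks ! j\<close>.\<close>

definition p_det :: "real Matrix.vec \<Rightarrow> nat list \<Rightarrow> real" where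
  "p_det p ks = (\<Sum>i\<in>set ks. p $ i)"

definition residual_prob :: "real Matrix.vec \<Rightarrow> nat list \<Rightarrow> nat \<Rightarrow> real" where
  "residual_prob p ks i =
     (if i < dim_vec p \<and> i \<notin> set ks then p $ i / (1 - p_det p ks) else 0)"

definition residual_pmf :: "real Matrix.vec \<Rightarrow> nat list \<Rightarrow> nat pmf" where
  "residual_pmf p ks = embed_pmf (residual_prob p ks)"

lemma pmf_residual_pmf:
  assumes p: "prob_vec p" and ks: "set ks \<subseteq> {..<dim_vec p}" and det: "p_det p ks < 1"
  shows "pmf (residual_pmf p ks) i = residual_prob p ks i"
proof -
  let ?N = "dim_vec p" and ?f = "residual_prob p ks"
  have nn: "0 \<le> ?f i" for i
    using p det unfolding prob_vec_def residual_prob_def by auto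
  have "(\<Sum>i<?N. p $ i) = (\<Sum>i\<in>{..<?N} - set ks. p $ i) + p_det p ks"
    unfolding p_det_def using ks by (intro sum.subset_diff) auto
  then have rest: "(\<Sum>i\<in>{..<?N} - set ks. p $ i) = 1 - p_det p ks"
    using p unfolding prob_vec_def by simp
  have "(\<integral>\<^sup>+ i. ennreal (?f i) \<partial>count_space UNIV)
      = (\<integral>\<^sup>+ i. ennreal (?f i) \<partial>count_space ({..<?N} - set ks))"
    by (rule nn_integral_count_space_eq) (auto simp: residual_prob_def)
  also have "\<dots> = (\<Sum>i\<in>{..<?N} - set ks. ennreal (?f i))"
    by (rule nn_integral_count_space_finite) simp
  also have "\<dots> = ennreal (\<Sum>i\<in>{..<?N} - set ks. ?f i)"
    using nn by (intro sum_ennreal) auto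
  also have "(\<Sum>i\<in>{..<?N} - set ks. ?f i) = (\<Sum>i\<in>{..<?N} - set ks. p $ i / (1 - p_det p ks))"
    by (intro sum.cong) (auto simp: residual_prob_def)
  also have "\<dots> = 1"
    unfolding sum_divide_distrib[symmetric] rest using det by simp
  finally show ?thesis unfolding residual_pmf_def using nn by (intro pmf_embed_pmf) auto
qed

definition hybrid_matrix :: "nat \<Rightarrow> real Matrix.vec \<Rightarrow> nat list \<Rightarrow> (nat \<Rightarrow> nat) \<Rightarrow> real mat" where
  "hybrid_matrix s p ks \<xi> =
     (let N = dim_vec p; s' = s - length ks in
        Matrix.mat (length ks) N (\<lambda>(j, i). if i = ks ! j then 1 else 0) @\<^sub>r
        Matrix.mat s' N (\<lambda>(j, i). if \<xi> j = i then 1 / sqrt (real s' * residual_prob p ks i) else 0))"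

text \<open>The law of the random matrix: \<^const>\<open>Pi_pmf\<close> makes the draws \<open>\<xi> 0, \<xi> 1, \<dots>\<close> independent
  (\<open>indep_vars_Pi_pmf\<close>), each distributed according to \<^const>\<open>residual_pmf\<close>.\<close>

definition hybrid_sample :: "nat \<Rightarrow> real Matrix.vec \<Rightarrow> nat list \<Rightarrow> real mat pmf" where
  "hybrid_sample s p ks =
     map_pmf (hybrid_matrix s p ks) (Pi_pmf {..<s - length ks} 0 (\<lambda>_. residual_pmf p ks))"

subsection \<open>Least squares\<close>

definition least_squares_minimizer :: "real mat \<Rightarrow> real mat \<Rightarrow> real mat \<Rightarrow> bool" where
  "least_squares_minimizer A B =
     is_arg_min (\<lambda>X. (frobenius_norm (A * X - B))\<^sup>2) (\<lambda>X. X \<in> carrier_mat (dim_col A) (dim_col B))"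

end

theory Submission
  imports Defs "HOL-Real_Asymp.Real_Asymp"
begin

text \<open>Write \<open>A = U R\<close> with \<open>U\<close> having orthonormal columns, and let \<open>W\<close> be the optimal
  residual, so \<open>U\<^sup>T W = 0\<close>. If \<open>U\<^sup>T S\<^sup>T S U \<ge> 1 / sqrt 2\<close> and
  \<open>U\<^sup>T S\<^sup>T S W\<close> has squared Frobenius norm at most \<open>\<epsilon> / 2\<close> times that of \<open>W\<close>, the
  normal equations of both problems and Pythagoras give the claim. The second condition fails with
  probability at most \<open>\<delta> / 2\<close> by Markov's inequality applied to a variance. The first one is a matrix
  Chernoff bound. It needs neither Lieb's theorem nor the Golden-Thompson inequality but only that, for
  \<open>0 \<le> Y \<le> K\<close>, the trace of \<open>exp (M - Y)\<close> is at most the trace of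
  \<open>exp M - (1 - exp (-K)) / K * Y exp M\<close>; in the eigenbases of neighbouring points of the segment from
  \<open>M\<close> to \<open>M - Y\<close> this reduces to scalar inequalities for \<open>exp\<close>.\<close>

subsection \<open>Spectral theorem for real symmetric matrices\<close>

text \<open>If \<open>M\<close> and \<open>Y\<close> commuted, the trace bound would be the chord
  inequality exp(-y) <= 1 - y (1 - exp(-K)) / K on [0, K]. In general exp(M - Y) does not factor.
  With f(t) = tr exp(M - t Y) and g(t) = tr (Y exp(M - t Y)) one has f' = -g and g' >= -K g, so g(t)
  >= exp(-K t) g(0), and integration over [0, 1] produces the same factor (1 - exp(-K)) / K. The
  formal proof works with difference versions of both relations.

  The constants belong together. A smallest eigenvalue of at least 1 / sqrt 2 bounds the squared
  error by (sqrt 2)^2 = 2 times the squared cross term, hence by 2 times \<epsilon> / 2 of the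
  optimum. The reciprocal of \<open>C\<close> is the scalar Chernoff rate h + (1 - h) ln (1 - h) for
  falling from mean 1 to 1 - h = 1 / sqrt 2. The factor 2 in front of \<open>C\<close> pays for
  doubling the norm bound of the random summands, the price of giving them a scalar mean.\<close>

definition ip :: "nat \<Rightarrow> (nat \<Rightarrow> real) \<Rightarrow> (nat \<Rightarrow> real) \<Rightarrow> real" where
  "ip n x y = (\<Sum>k<n. x k * y k)"

text \<open>Vectors and matrices are plain functions of which only the values at indices below
  \<open>n\<close> matter. Sums and multiples are then lambda terms, and
  \<open>nat \<Rightarrow> real\<close> brings the product topology used for the maximization
  below.\<close>

definition mv :: "nat \<Rightarrow> (nat \<Rightarrow> nat \<Rightarrow> real) \<Rightarrow> (nat \<Rightarrow> real) \<Rightarrow> nat \<Rightarrow> real" where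
  "mv n M x k = (\<Sum>l<n. M k l * x l)"

definition sym_mat :: "nat \<Rightarrow> (nat \<Rightarrow> nat \<Rightarrow> real) \<Rightarrow> bool" where
  "sym_mat n M \<longleftrightarrow> (\<forall>k<n. \<forall>l<n. M k l = M l k)"

definition orthonormal_sys :: "nat \<Rightarrow> nat \<Rightarrow> (nat \<Rightarrow> nat \<Rightarrow> real) \<Rightarrow> bool" where
  "orthonormal_sys n m u \<longleftrightarrow> (\<forall>i<m. \<forall>j<m. ip n (u i) (u j) = (if i = j then 1 else 0))"

definition eigenbasis :: "nat \<Rightarrow> (nat \<Rightarrow> nat \<Rightarrow> real) \<Rightarrow> (nat \<Rightarrow> real) \<Rightarrow> (nat \<Rightarrow> nat \<Rightarrow> real) \<Rightarrow> bool" where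
  "eigenbasis n M a u \<longleftrightarrow>
     orthonormal_sys n n u \<and> (\<forall>i<n. \<forall>k<n. mv n M (u i) k = a i * u i k)"

lemma ip_commute: "ip n x y = ip n y x"
  by (simp add: ip_def mult.commute)

lemma ip_cong: "(\<And>k. k < n \<Longrightarrow> x k = x' k) \<Longrightarrow> (\<And>k. k < n \<Longrightarrow> y k = y' k) \<Longrightarrow> ip n x y = ip n x' y'"
  by (simp add: ip_def)

lemma ip_add_left: "ip n (\<lambda>k. x k + y k) z = ip n x z + ip n y z"
  and ip_diff_left: "ip n (\<lambda>k. x k - y k) z = ip n x z - ip n y z"
  and ip_scale_left: "ip n (\<lambda>k. c * x k) z = c * ip n x z"
  and ip_sum_left: "ip n (\<lambda>k. \<Sum>i\<in>I. f i k) z = (\<Sum>i\<in>I. ip n (f i) z)"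
  by (simp_all add: ip_def algebra_simps sum.distrib sum_subtractf sum_distrib_left sum_distrib_right
      sum.swap[of _ I])

lemma ip_add_right: "ip n z (\<lambda>k. x k + y k) = ip n z x + ip n z y"
  and ip_diff_right: "ip n z (\<lambda>k. x k - y k) = ip n z x - ip n z y"
  and ip_scale_right: "ip n z (\<lambda>k. c * x k) = c * ip n z x"
  and ip_sum_right: "ip n z (\<lambda>k. \<Sum>i\<in>I. f i k) = (\<Sum>i\<in>I. ip n z (f i))"
  by (simp_all add: ip_commute[of n z] ip_add_left ip_diff_left ip_scale_left ip_sum_left)

lemmas ip_linear = ip_add_left ip_diff_left ip_scale_left ip_sum_left
  ip_add_right ip_diff_right ip_scale_right ip_sum_right

lemma ip_self_nonneg: "0 \<le> ip n x x"
  by (simp add: ip_def sum_nonneg)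

lemma ip_self_eq_0: "ip n x x = 0 \<longleftrightarrow> (\<forall>k<n. x k = 0)"
  by (auto simp: ip_def sum_nonneg_eq_0_iff)

lemma mv_linear:
  "mv n M (\<lambda>k. x k + y k) = (\<lambda>k. mv n M x k + mv n M y k)"
  "mv n M (\<lambda>k. x k - y k) = (\<lambda>k. mv n M x k - mv n M y k)"
  "mv n M (\<lambda>k. c * x k) = (\<lambda>k. c * mv n M x k)"
  "mv n (\<lambda>k l. M k l + M' k l) x = (\<lambda>k. mv n M x k + mv n M' x k)"
  "mv n (\<lambda>k l. M k l - M' k l) x = (\<lambda>k. mv n M x k - mv n M' x k)"
  "mv n (\<lambda>k l. c * M k l) x = (\<lambda>k. c * mv n M x k)"
  "mv n (\<lambda>k l. \<Sum>i\<in>I. F i k l) x = (\<lambda>k. \<Sum>i\<in>I. mv n (F i) x k)"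
  by (auto simp: mv_def fun_eq_iff algebra_simps sum.distrib sum_subtractf sum_distrib_left
      sum_distrib_right sum.swap[of _ I])

lemma sym_matD: "sym_mat n M \<Longrightarrow> ip n x (mv n M y) = ip n (mv n M x) y"
  unfolding ip_def mv_def sum_distrib_left sum_distrib_right sym_mat_def
  by (subst sum.swap) (auto intro!: sum.cong simp: mult_ac)

section \<open>Completeness of orthonormal systems and Parseval's identity\<close>

lemma orthonormal_residual:
  assumes u: "orthonormal_sys n m u" 
  defines "e l \<equiv> (\<lambda>k. if k = l then 1 else 0 :: real)"
  defines "z l \<equiv> (\<lambda>k. e l k - (\<Sum>i<m. u i l * u i k))"
  assumes l: "l < n"
  shows "i < m \<Longrightarrow> ip n (z l) (u i) = 0" "ip n (z l) (z l) = 1 - (\<Sum>i<m. (u i l)\<^sup>2)"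
proof -
  have e: "ip n (e l) x = x l" for x
    using l by (simp add: ip_def e_def if_distrib[of "\<lambda>c. c * _"] cong: if_cong)
  have *: "ip n (z l) (u i) = 0" if i: "i < m" for i
  proof -
    have "(\<Sum>j<m. u j l * ip n (u j) (u i)) = (\<Sum>j<m. if j = i then u j l else 0)"
      using u i by (intro sum.cong) (auto simp: orthonormal_sys_def)
    then show ?thesis using i by (simp add: z_def ip_linear e)
  qed
  have "ip n (z l) (z l) = ip n (z l) (e l) - (\<Sum>i<m. u i l * ip n (z l) (u i))"
    by (subst (2) z_def) (simp add: ip_linear)
  also have "\<dots> = 1 - (\<Sum>i<m. (u i l)\<^sup>2)"
    using * by (simp add: ip_commute[of n "z l" "e l"] e)
      (simp add: z_def e_def power2_eq_square)
  finally show "ip n (z l) (z l) = 1 - (\<Sum>i<m. (u i l)\<^sup>2)" .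
  show "i < m \<Longrightarrow> ip n (z l) (u i) = 0" by (rule *)
qed

lemma orthonormal_sys_norm_sum:
  assumes u: "orthonormal_sys n m u"
  shows "(\<Sum>l<n. \<Sum>i<m. (u i l)\<^sup>2) = real m"
proof -
  have "(\<Sum>l<n. \<Sum>i<m. (u i l)\<^sup>2) = (\<Sum>i<m. ip n (u i) (u i))"
    by (subst sum.swap) (simp add: ip_def power2_eq_square)
  also have "\<dots> = (\<Sum>i<m. 1)" using u by (intro sum.cong) (auto simp: orthonormal_sys_def)
  finally show ?thesis by simp
qed

text \<open>The squared lengths of the residuals of the unit vectors sum to \<open>n - m\<close>,
  the trace of the projection onto the orthogonal complement. For \<open>m = n\<close> all of them
  therefore vanish; for \<open>m < n\<close> one is nonzero, which gives
  \<open>eigenvector_extend\<close> a vector to start from.\<close>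

lemma orthonormal_sys_complete:
  assumes u: "orthonormal_sys n n u" and k: "k < n" and l: "l < n"
  shows "(\<Sum>i<n. u i k * u i l) = (if k = l then 1 else 0)"
proof -
  define z where "z l = (\<lambda>k. (if k = l then 1 else 0 :: real) - (\<Sum>i<n. u i l * u i k))" for l
  have zz: "ip n (z l) (z l) = 1 - (\<Sum>i<n. (u i l)\<^sup>2)" if "l < n" for l
    using orthonormal_residual(2)[OF u that] unfolding z_def .
  have "(\<Sum>l<n. ip n (z l) (z l)) = 0"
    using orthonormal_sys_norm_sum[OF u] by (simp add: zz sum_subtractf)
  then have "ip n (z l) (z l) = 0" using l
    by (subst (asm) sum_nonneg_eq_0_iff) (auto simp: ip_self_nonneg)
  then have "z l k = 0" using k by (simp add: ip_self_eq_0)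
  then show ?thesis by (simp add: z_def mult.commute)
qed

lemma parseval:
  assumes u: "orthonormal_sys n n u"
  shows "ip n x y = (\<Sum>i<n. ip n x (u i) * ip n (u i) y)"
proof -
  have "(\<Sum>i<n. ip n x (u i) * ip n (u i) y) = (\<Sum>i<n. \<Sum>k<n. \<Sum>l<n. x k * y l * (u i k * u i l))"
    by (simp add: ip_def sum_product mult_ac)
  also have "\<dots> = (\<Sum>k<n. \<Sum>l<n. \<Sum>i<n. x k * y l * (u i k * u i l))"
    by (subst sum.swap, rule sum.cong[OF refl], subst sum.swap, simp)
  also have "\<dots> = (\<Sum>k<n. \<Sum>l<n. x k * y l * (if k = l then 1 else 0))"
    using orthonormal_sys_complete[OF u] by (simp add: sum_distrib_left[symmetric])
  also have "\<dots> = ip n x y"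
    by (simp add: ip_def if_distrib[of "\<lambda>c. _ * c"] cong: if_cong)
  finally show ?thesis by simp
qed

section \<open>Existence of an orthonormal eigenbasis\<close>

lemma compact_unit_box: "compact {x :: nat \<Rightarrow> real. (\<forall>k. \<bar>x k\<bar> \<le> 1)}"
proof -
  have "compactin (product_topology (\<lambda>_::nat. euclidean) UNIV) (PiE UNIV (\<lambda>_. {-1..1::real}))"
    unfolding compactin_PiE by (auto simp: compactin_euclidean_iff)
  moreover have "PiE UNIV (\<lambda>_. {-1..1::real}) = {x :: nat \<Rightarrow> real. (\<forall>k. \<bar>x k\<bar> \<le> 1)}"
    by (auto simp: PiE_def abs_le_iff) 
  ultimately show ?thesis by (simp add: euclidean_product_topology)
qed

lemma continuous_on_ip: "continuous_on UNIV (\<lambda>x. ip n x y)" "continuous_on UNIV (\<lambda>x. ip n x x)"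
  "continuous_on UNIV (\<lambda>x. ip n x (mv n M x))"
  unfolding ip_def mv_def
  by (intro continuous_intros continuous_on_product_coordinates)+

lemma closed_eq_continuous:
  "continuous_on UNIV f \<Longrightarrow> closed {x. f x = (c::real)}" for f :: "_::topological_space \<Rightarrow> real"
  using closed_vimage[of "{c}" f] by (simp add: vimage_def)

text \<open>The next eigenvector maximizes the quadratic form on the unit sphere of the orthogonal
  complement of the previous ones.\<close>

lemma eigenvector_extend:
  assumes M: "sym_mat n M" and u: "orthonormal_sys n m u" and m: "m < n"
    and eig: "\<And>i k. i < m \<Longrightarrow> k < n \<Longrightarrow> mv n M (u i) k = a i * u i k"
  obtains x c where "ip n x x = 1" "\<And>i. i < m \<Longrightarrow> ip n x (u i) = 0"
    "\<And>k. k < n \<Longrightarrow> mv n M x k = c * x k"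
proof -
  \<comment> \<open>Coordinates from \<open>n\<close> on are invisible to \<open>ip n\<close>, so
    the unit sphere alone is not compact; its intersection with the box is, by Tychonoff.\<close>
  define S where "S = {x. (\<forall>k. \<bar>x k\<bar> \<le> 1) \<and> (ip n x x = 1 \<and> (\<forall>i<m. ip n x (u i) = 0))}"
  have normalize: "\<exists>x\<in>S. \<exists>d>0. (\<forall>k<n. y k = d * x k)"
    if "ip n y y > 0" "\<forall>i<m. ip n y (u i) = 0" for y
  proof -
    define d where "d = sqrt (ip n y y)"
    have d: "d > 0" "d * d = ip n y y" using that(1) by (auto simp: d_def)
    \<comment> \<open>Truncation at \<open>n\<close> keeps the normalized vector in the box.\<close>
    define x where "x = (\<lambda>k. if k < n then (1 / d) * y k else 0)"
    have x: "ip n x z = (1 / d) * ip n y z" for z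
      by (subst ip_scale_left[symmetric], rule ip_cong) (auto simp: x_def)
    have xx: "ip n x x = 1" using d(1) by (simp add: x ip_commute[of n y x] d(2)[symmetric])
    have "(x k)\<^sup>2 \<le> 1" for k
    proof (cases "k < n")
      case True
      then have "(x k)\<^sup>2 \<le> ip n x x" unfolding ip_def power2_eq_square[symmetric]
        by (intro member_le_sum) auto
      then show ?thesis using xx by simp
    qed (simp add: x_def)
    then have "\<forall>k. \<bar>x k\<bar> \<le> 1" by (simp add: abs_square_le_1)
    then have "x \<in> S" using xx that(2) by (simp add: S_def x)
    moreover have "\<forall>k<n. y k = d * x k" using d by (simp add: x_def)
    ultimately show ?thesis using d(1) by blast
  qed
  have "S \<noteq> {}"
  proof -
    define z where "z l = (\<lambda>k. (if k = l then 1 else 0 :: real) - (\<Sum>i<m. u i l * u i k))" for l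
    have zz: "ip n (z l) (z l) = 1 - (\<Sum>i<m. (u i l)\<^sup>2)" 
     and zu: "i < m \<Longrightarrow> ip n (z l) (u i) = 0" if "l < n" for l i
      using orthonormal_residual[OF u that] unfolding z_def by auto
    have "(\<Sum>l<n. ip n (z l) (z l)) = real n - real m"
      using orthonormal_sys_norm_sum[OF u] by (simp add: zz sum_subtractf)
    then have "(\<Sum>l<n. ip n (z l) (z l)) > 0" using m by simp
    then obtain l where l: "l < n" "ip n (z l) (z l) > 0"
      by (metis (no_types, lifting) lessThan_iff linorder_not_le sum_nonpos)
    then show ?thesis using normalize[of "z l"] zu[OF l(1)] by blast
  qed
  moreover have "compact S"
  proof -
    have "S = {x. \<forall>k. \<bar>x k\<bar> \<le> 1} \<inter> ({x. ip n x x = 1} \<inter> (\<Inter>i\<in>{..<m}. {x. ip n x (u i) = 0}))"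
      by (auto simp: S_def)
    moreover have "compact \<dots>"
      by (intro compact_Int_closed compact_unit_box closed_Int closed_INT ballI
          closed_eq_continuous continuous_on_ip)
    ultimately show ?thesis by (rule ssubst)
  qed
  moreover have "continuous_on S (\<lambda>x. ip n x (mv n M x))"
    using continuous_on_ip(3) by (rule continuous_on_subset) simp
  ultimately obtain x where x: "x \<in> S" and max: "\<And>y. y \<in> S \<Longrightarrow> ip n y (mv n M y) \<le> ip n x (mv n M x)"
    using continuous_attains_sup[of S "\<lambda>x. ip n x (mv n M x)"] by blast
  define c where "c = ip n x (mv n M x)"
  have xx: "ip n x x = 1" and xu: "\<And>i. i < m \<Longrightarrow> ip n x (u i) = 0" using x by (auto simp: S_def)
  have le: "ip n y (mv n M y) \<le> c * ip n y y" if y0: "\<forall>i<m. ip n y (u i) = 0" for y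
  proof (cases "ip n y y > 0")
    case True
    then obtain x' d where x': "x' \<in> S" and d: "d > 0" and y: "\<forall>k<n. y k = d * x' k"
      using normalize[OF True y0] by blast
    have "mv n M y k = d * mv n M x' k" for k
      using y by (simp add: mv_def sum_distrib_left mult_ac)
    then have "ip n y (mv n M y) = ip n (\<lambda>k. d * x' k) (\<lambda>k. d * mv n M x' k)"
      using y by (intro ip_cong) auto
    moreover have "ip n y y = ip n (\<lambda>k. d * x' k) (\<lambda>k. d * x' k)"
      using y by (intro ip_cong) auto
    moreover have "d * (d * ip n x' (mv n M x')) \<le> d * (d * c)"
      using d max[OF x'] by (simp add: c_def)
    ultimately show ?thesis using x' by (simp add: S_def ip_linear mult_ac)
  next
    case False
    then have "\<forall>k<n. y k = 0" using ip_self_nonneg[of n y] ip_self_eq_0[of n y] by simp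
    then have "ip n y z = 0" for z by (simp add: ip_def)
    then show ?thesis by simp
  qed
  \<comment> \<open>\<open>w\<close> is the component of \<open>M x\<close> orthogonal to
    \<open>x\<close>. It is also orthogonal to the earlier eigenvectors, so \<open>x + t * w\<close>
    competes with \<open>x\<close> for every \<open>t\<close>.\<close>
  define w where "w = (\<lambda>k. mv n M x k - c * x k)"
  have wx: "ip n w x = 0" using xx by (simp add: w_def ip_linear c_def ip_commute)
  have wu: "ip n w (u i) = 0" if "i < m" for i
  proof -
    have "ip n (mv n M x) (u i) = ip n x (mv n M (u i))" by (rule sym_matD[OF M, symmetric])
    also have "\<dots> = ip n x (\<lambda>k. a i * u i k)" using eig that by (intro ip_cong) auto
    also have "\<dots> = 0" using xu that by (simp add: ip_linear)
    finally show ?thesis using xu that by (simp add: w_def ip_linear)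
  qed
  have wM: "ip n w (mv n M x) = ip n w w" using wx by (subst (3) w_def) (simp add: ip_linear)
  \<comment> \<open>First-order optimality: a term linear in \<open>t\<close> that is dominated by a
    multiple of \<open>t\<^sup>2\<close> for all \<open>t\<close> must vanish.\<close>
  have quad: "2 * ip n w w * t \<le> (c * ip n w w - ip n w (mv n M w)) * t\<^sup>2" for t
  proof -
    have "\<forall>i<m. ip n (\<lambda>k. x k + t * w k) (u i) = 0" using xu wu by (simp add: ip_linear)
    then have "ip n (\<lambda>k. x k + t * w k) (mv n M (\<lambda>k. x k + t * w k))
      \<le> c * ip n (\<lambda>k. x k + t * w k) (\<lambda>k. x k + t * w k)" by (rule le)
    also have "ip n (\<lambda>k. x k + t * w k) (\<lambda>k. x k + t * w k) = 1 + t\<^sup>2 * ip n w w"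
      using xx wx ip_commute[of n x w] by (simp add: ip_add_left ip_add_right ip_scale_left
          ip_scale_right power2_eq_square)
    also have "ip n (\<lambda>k. x k + t * w k) (mv n M (\<lambda>k. x k + t * w k))
      = c + 2 * ip n w w * t + t\<^sup>2 * ip n w (mv n M w)"
    proof -
      have "ip n x (mv n M w) = ip n w w"
        using sym_matD[OF M, of x w] ip_commute[of n "mv n M x" w] wM by simp
      then show ?thesis using wM
        by (simp add: mv_linear ip_add_left ip_add_right ip_scale_left
          ip_scale_right power2_eq_square c_def[symmetric] algebra_simps)
    qed
    finally show ?thesis by (simp add: algebra_simps)
  qed
  have "ip n w w = 0"
  proof (rule ccontr)
    assume "ip n w w \<noteq> 0"
    then have w: "ip n w w > 0" using ip_self_nonneg[of n w] by simp
    define q where "q = \<bar>c * ip n w w - ip n w (mv n M w)\<bar> + 1"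
    \<comment> \<open>At this \<open>t\<close> the bound would give
      \<open>2 * ip n w w \<le> ip n w w\<close>.\<close>
    define t where "t = ip n w w / q"
    have q: "q > 0" by (simp add: q_def)
    then have t: "t > 0" using w by (simp add: t_def)
    have "2 * ip n w w * t \<le> q * t\<^sup>2"
      by (rule order_trans[OF quad]) (intro mult_right_mono, auto simp: q_def)
    then have "2 * ip n w w \<le> q * t" using t by (simp add: power2_eq_square)
    then show False using w q by (simp add: t_def)
  qed
  then have "mv n M x k = c * x k" if "k < n" for k using that by (simp add: ip_self_eq_0 w_def)
  then show ?thesis using that xx xu by blast
qed

theorem eigenbasis_exists:
  assumes M: "sym_mat n M"
  shows "\<exists>a u. eigenbasis n M a u"
proof -
  have "\<exists>a u. orthonormal_sys n m u \<and> (\<forall>i<m. \<forall>k<n. mv n M (u i) k = a i * u i k)" if "m \<le> n" for m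
    using that
  proof (induction m)
    case 0
    then show ?case by (auto simp: orthonormal_sys_def)
  next
    case (Suc m)
    then obtain a u where u: "orthonormal_sys n m u"
      and eig: "\<And>i k. i < m \<Longrightarrow> k < n \<Longrightarrow> mv n M (u i) k = a i * u i k" by auto
    obtain x c where x: "ip n x x = 1" "\<And>i. i < m \<Longrightarrow> ip n x (u i) = 0"
      "\<And>k. k < n \<Longrightarrow> mv n M x k = c * x k"
      using eigenvector_extend[OF M u _ eig] Suc.prems Suc_le_lessD by metis
    have "orthonormal_sys n (Suc m) (u(m := x))"
    proof -
      have "ip n (u i) x = 0" if "i < m" for i using x(2)[OF that] ip_commute by metis
      then show ?thesis using u x(1,2) by (simp add: orthonormal_sys_def less_Suc_eq)
    qed
    moreover have "\<forall>i<Suc m. \<forall>k<n. mv n M ((u(m := x)) i) k = (a(m := c)) i * (u(m := x)) i k"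
      using eig x(3) by (simp add: less_Suc_eq)
    ultimately show ?case by (intro exI conjI)
  qed
  then show ?thesis by (auto simp: eigenbasis_def)
qed

subsection \<open>Traces of exponentials along a segment\<close>

text \<open>With \<open>exp M\<close> read off from a chosen eigenbasis, \<open>trexp_mult n M Y\<close> is the trace of
  \<open>Y exp M\<close>.\<close>

definition spectral :: "nat \<Rightarrow> (nat \<Rightarrow> nat \<Rightarrow> real) \<Rightarrow> (nat \<Rightarrow> real) \<times> (nat \<Rightarrow> nat \<Rightarrow> real)" where
  "spectral n M = (SOME (a, u). eigenbasis n M a u)"

definition trexp :: "nat \<Rightarrow> (nat \<Rightarrow> nat \<Rightarrow> real) \<Rightarrow> real" where
  "trexp n M = (let (a, u) = spectral n M in \<Sum>i<n. exp (a i))"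

definition trexp_mult :: "nat \<Rightarrow> (nat \<Rightarrow> nat \<Rightarrow> real) \<Rightarrow> (nat \<Rightarrow> nat \<Rightarrow> real) \<Rightarrow> real" where
  "trexp_mult n M Y = (let (a, u) = spectral n M in \<Sum>i<n. exp (a i) * ip n (u i) (mv n Y (u i)))"

lemma spectral_obtain:
  assumes "sym_mat n M"
  obtains a u where "eigenbasis n M a u" "trexp n M = (\<Sum>i<n. exp (a i))"
    "\<And>Y. trexp_mult n M Y = (\<Sum>i<n. exp (a i) * ip n (u i) (mv n Y (u i)))"
proof -
  obtain a u where au: "spectral n M = (a, u)" by (cases "spectral n M")
  have "case spectral n M of (a, u) \<Rightarrow> eigenbasis n M a u"
    unfolding spectral_def
  proof (rule someI_ex)
    show "\<exists>z. case z of (a, u) \<Rightarrow> eigenbasis n M a u"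
      using eigenbasis_exists[OF assms] by simp
  qed
  then show ?thesis using au by (intro that[of a u]) (simp_all add: trexp_def trexp_mult_def)
qed

text \<open>The eigenbasis is chosen from \<open>M\<close> alone, so the expression is linear in the
  second matrix whatever the choice. Expectations are moved inside through this.\<close>

lemma trexp_mult_linear:
  "trexp_mult n M (\<lambda>k l. c * Y k l) = c * trexp_mult n M Y"
  "trexp_mult n M (\<lambda>k l. \<Sum>i\<in>I. F i k l) = (\<Sum>i\<in>I. trexp_mult n M (F i))"
  by (simp_all add: trexp_mult_def case_prod_beta mv_linear ip_linear sum_distrib_left
      sum.swap[of _ I] mult_ac)

lemma trexp_mult_scalar:
  assumes M: "sym_mat n M" and Y: "\<And>k l. k < n \<Longrightarrow> l < n \<Longrightarrow> Y k l = (if k = l then c else 0)"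
  shows "trexp_mult n M Y = c * trexp n M"
proof -
  obtain a u where eb: "eigenbasis n M a u" and T: "trexp n M = (\<Sum>i<n. exp (a i))"
    and TY: "trexp_mult n M Y = (\<Sum>i<n. exp (a i) * ip n (u i) (mv n Y (u i)))"
    using spectral_obtain[OF M] by metis
  have "mv n Y x k = c * x k" if "k < n" for x k
  proof -
    have "mv n Y x k = (\<Sum>l<n. if k = l then c * x l else 0)"
      unfolding mv_def using Y that by (intro sum.cong) auto
    then show ?thesis using that by simp
  qed
  then have "ip n (u i) (mv n Y (u i)) = ip n (u i) (\<lambda>k. c * u i k)" for i
    by (intro ip_cong) auto
  then have "ip n (u i) (mv n Y (u i)) = c" if "i < n" for i
    using eb that by (simp add: ip_linear eigenbasis_def orthonormal_sys_def)
  then show ?thesis unfolding T TY by (simp add: sum_distrib_left mult.commute)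
qed

lemma trexp_zero:
  assumes "\<And>k l. k < n \<Longrightarrow> l < n \<Longrightarrow> M k l = 0"
  shows "trexp n M = real n"
proof -
  have "sym_mat n M" using assms by (simp add: sym_mat_def)
  then obtain a u where eb: "eigenbasis n M a u" and T: "trexp n M = (\<Sum>i<n. exp (a i))"
    using spectral_obtain by metis
  have "a i = 0" if "i < n" for i
  proof -
    have "ip n (u i) (\<lambda>k. a i * u i k) = ip n (u i) (mv n M (u i))"
      using eb that by (intro ip_cong) (auto simp: eigenbasis_def)
    also have "\<dots> = 0" using assms by (simp add: mv_def ip_def)
    finally show ?thesis using eb that by (simp add: ip_linear eigenbasis_def orthonormal_sys_def)
  qed
  then show ?thesis unfolding T by simp
qed

lemma trexp_nonneg: "0 \<le> trexp n M"
  by (simp add: trexp_def case_prod_beta sum_nonneg)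

text \<open>The form at a unit vector is the average of the eigenvalues with weights
  \<open>(ip n (u i) x)\<^sup>2\<close>, so some eigenvalue is at least as large, and its
  exponential is one term of the trace.\<close>

lemma trexp_ge_exp_quadratic:
  assumes M: "sym_mat n M" and x: "ip n x x = 1"
  shows "exp (ip n x (mv n M x)) \<le> trexp n M"
proof -
  obtain a u where eb: "eigenbasis n M a u" and T: "trexp n M = (\<Sum>i<n. exp (a i))"
    using spectral_obtain[OF M] by metis
  have u: "orthonormal_sys n n u" using eb by (simp add: eigenbasis_def)
  have Mu: "ip n (u i) (mv n M x) = a i * ip n (u i) x" if "i < n" for i
  proof -
    have "ip n (u i) (mv n M x) = ip n (mv n M (u i)) x" by (rule sym_matD[OF M])
    also have "\<dots> = ip n (\<lambda>k. a i * u i k) x"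
      using eb that by (intro ip_cong) (auto simp: eigenbasis_def)
    finally show ?thesis by (simp add: ip_linear)
  qed
  have xx: "(\<Sum>i<n. (ip n (u i) x)\<^sup>2) = 1"
    using parseval[OF u, of x x] x by (simp add: power2_eq_square ip_commute[of n x "u _"])
  have xMx: "ip n x (mv n M x) = (\<Sum>i<n. (ip n (u i) x)\<^sup>2 * a i)"
    using Mu by (simp add: parseval[OF u, of x "mv n M x"] ip_commute[of n x "u _"]
        power2_eq_square mult_ac)
  have "\<exists>i<n. ip n x (mv n M x) \<le> a i"
  proof (rule ccontr)
    assume neg: "\<not> ?thesis"
    have "(\<Sum>i<n. (ip n (u i) x)\<^sup>2 * (c - a i)) = (\<Sum>i<n. (ip n (u i) x)\<^sup>2) * c
        - (\<Sum>i<n. (ip n (u i) x)\<^sup>2 * a i)" for c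
      by (simp add: right_diff_distrib sum_subtractf sum_distrib_right)
    from this[of "ip n x (mv n M x)"]
    have "(\<Sum>i<n. (ip n (u i) x)\<^sup>2 * (ip n x (mv n M x) - a i)) = 0"
      by (simp only: xx xMx[symmetric] mult_1_left diff_self)
    then have "(ip n (u i) x)\<^sup>2 * (ip n x (mv n M x) - a i) = 0" if "i < n" for i
      using that neg by (subst (asm) sum_nonneg_eq_0_iff) (auto simp: not_le less_imp_le)
    then have "(ip n (u i) x)\<^sup>2 = 0" if "i < n" for i using that neg by fastforce
    then show False using xx by simp
  qed
  then obtain i where i: "i < n" "ip n x (mv n M x) \<le> a i" by blast
  have "exp (ip n x (mv n M x)) \<le> exp (a i)" using i by simp
  also have "\<dots> \<le> trexp n M" unfolding T using i(1) by (intro member_le_sum) auto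
  finally show ?thesis .
qed

text \<open>For symmetric \<open>M\<close> and \<open>M'\<close> the overlaps of their eigenvectors form a doubly stochastic
  matrix, over which all traces below become weighted averages of scalar expressions in
  the two spectra.\<close>

lemma trexp_joint:
  assumes M: "sym_mat n M" and M': "sym_mat n M'"
    and D: "\<And>k l. D k l = M k l - M' k l"
    and K: "\<And>x. ip n (mv n D x) (mv n D x) \<le> K * ip n x (mv n D x)"
  obtains a b w where
    "\<forall>i j. (0::real) \<le> w i j"
    "trexp n M = (\<Sum>i<n. \<Sum>j<n. w i j * exp (a i))"
    "trexp n M' = (\<Sum>i<n. \<Sum>j<n. w i j * exp (b j))"
    "trexp_mult n M D = (\<Sum>i<n. \<Sum>j<n. w i j * (exp (a i) * (a i - b j)))"
    "trexp_mult n M' D = (\<Sum>i<n. \<Sum>j<n. w i j * (exp (b j) * (a i - b j)))"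
    "(\<Sum>i<n. \<Sum>j<n. w i j * (exp (a i) * (a i - b j)\<^sup>2)) \<le> K * trexp_mult n M D"
    "(\<Sum>i<n. \<Sum>j<n. w i j * (exp (b j) * (a i - b j)\<^sup>2)) \<le> K * trexp_mult n M' D"
proof -
  obtain a u where eb: "eigenbasis n M a u" and T: "trexp n M = (\<Sum>i<n. exp (a i))"
    and TY: "\<And>Y. trexp_mult n M Y = (\<Sum>i<n. exp (a i) * ip n (u i) (mv n Y (u i)))"
    using spectral_obtain[OF M] by metis
  obtain b v where eb': "eigenbasis n M' b v" and T': "trexp n M' = (\<Sum>i<n. exp (b i))"
    and TY': "\<And>Y. trexp_mult n M' Y = (\<Sum>i<n. exp (b i) * ip n (v i) (mv n Y (v i)))"
    using spectral_obtain[OF M'] by metis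
  have u: "orthonormal_sys n n u" and v: "orthonormal_sys n n v"
    using eb eb' by (auto simp: eigenbasis_def)
  have uu: "ip n (u i) (u i) = 1" and vv: "ip n (v i) (v i) = 1" if "i < n" for i
    using u v that by (auto simp: orthonormal_sys_def)
  have Dsym: "sym_mat n D" using M M' by (simp add: sym_mat_def D)
  define q where "q i j = ip n (u i) (v j)" for i j
  define w where "w i j = (q i j)\<^sup>2" for i j
  have Deq: "D = (\<lambda>k l. M k l - M' k l)" using D by (simp add: fun_eq_iff)
  \<comment> \<open>Letting \<open>M\<close> act on \<open>u i\<close> and \<open>M'\<close> on
    \<open>v j\<close> makes \<open>M - M'\<close> explicit between the two bases, although in
    general neither diagonalizes it.\<close>
  have uDv: "ip n (u i) (mv n D (v j)) = (a i - b j) * q i j" if i: "i < n" and j: "j < n" for i j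
  proof -
    have "ip n (u i) (mv n D (v j)) = ip n (u i) (mv n M (v j)) - ip n (u i) (mv n M' (v j))"
      by (simp add: Deq mv_linear ip_linear)
    also have "ip n (u i) (mv n M (v j)) = ip n (\<lambda>k. a i * u i k) (v j)"
      unfolding sym_matD[OF M] using eb i by (intro ip_cong) (auto simp: eigenbasis_def)
    also have "ip n (u i) (mv n M' (v j)) = ip n (u i) (\<lambda>k. b j * v j k)"
      using eb' j by (intro ip_cong) (auto simp: eigenbasis_def)
    finally show ?thesis by (simp add: ip_linear q_def algebra_simps)
  qed
  have vDu: "ip n (v j) (mv n D (u i)) = (a i - b j) * q i j" if i: "i < n" and j: "j < n" for i j
    using uDv[OF that] sym_matD[OF Dsym, of "v j" "u i"] ip_commute by metis
  have wi: "(\<Sum>j<n. w i j) = 1" if "i < n" for i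
    using parseval[OF v, of "u i" "u i"] uu[OF that]
    by (simp add: w_def q_def power2_eq_square ip_commute[of n "v _" "u _"])
  have wj: "(\<Sum>i<n. w i j) = 1" if "j < n" for j
    using parseval[OF u, of "v j" "v j"] vv[OF that]
    by (simp add: w_def q_def power2_eq_square ip_commute[of n "v _" "u _"])
  have uDu: "ip n (u i) (mv n D (u i)) = (\<Sum>j<n. w i j * (a i - b j))" if "i < n" for i
    using that vDu by (simp add: parseval[OF v, of "u i" "mv n D (u i)"] q_def[symmetric] w_def
        power2_eq_square mult_ac)
  have vDv: "ip n (v j) (mv n D (v j)) = (\<Sum>i<n. w i j * (a i - b j))" if "j < n" for j
    using that uDv by (simp add: parseval[OF u, of "v j" "mv n D (v j)"] ip_commute[of n "v _" "u _"]
        q_def[symmetric] w_def power2_eq_square mult_ac)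
  have DuDu: "ip n (mv n D (u i)) (mv n D (u i)) = (\<Sum>j<n. w i j * (a i - b j)\<^sup>2)" if "i < n" for i
    using that vDu by (simp add: parseval[OF v, of "mv n D (u i)" "mv n D (u i)"]
        ip_commute[of n "mv n D (u i)" "v _"] w_def power2_eq_square mult_ac)
  have DvDv: "ip n (mv n D (v j)) (mv n D (v j)) = (\<Sum>i<n. w i j * (a i - b j)\<^sup>2)" if "j < n" for j
    using that uDv by (simp add: parseval[OF u, of "mv n D (v j)" "mv n D (v j)"]
        ip_commute[of n "mv n D (v j)" "u _"] w_def power2_eq_square mult_ac)
  have TM: "trexp_mult n M D = (\<Sum>i<n. \<Sum>j<n. w i j * (exp (a i) * (a i - b j)))"
    using uDu by (simp add: TY sum_distrib_left mult_ac)
  have TM': "trexp_mult n M' D = (\<Sum>i<n. \<Sum>j<n. w i j * (exp (b j) * (a i - b j)))"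
    using vDv by (subst sum.swap) (simp add: TY' sum_distrib_left mult_ac)
  show ?thesis
  proof (rule that[of w a b])
    show "\<forall>i j. 0 \<le> w i j" by (simp add: w_def)
    show "trexp n M = (\<Sum>i<n. \<Sum>j<n. w i j * exp (a i))"
      using wi by (simp add: T sum_distrib_right[symmetric])
    show "trexp n M' = (\<Sum>i<n. \<Sum>j<n. w i j * exp (b j))"
      using wj by (subst sum.swap) (simp add: T' sum_distrib_right[symmetric])
    show "trexp_mult n M D = (\<Sum>i<n. \<Sum>j<n. w i j * (exp (a i) * (a i - b j)))" by (rule TM)
    show "trexp_mult n M' D = (\<Sum>i<n. \<Sum>j<n. w i j * (exp (b j) * (a i - b j)))" by (rule TM')
    have "(\<Sum>i<n. \<Sum>j<n. w i j * (exp (a i) * (a i - b j)\<^sup>2))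
        = (\<Sum>i<n. exp (a i) * ip n (mv n D (u i)) (mv n D (u i)))"
      using DuDu by (simp add: sum_distrib_left mult_ac)
    also have "\<dots> \<le> (\<Sum>i<n. exp (a i) * (K * ip n (u i) (mv n D (u i))))"
      using K by (intro sum_mono mult_left_mono) auto
    also have "\<dots> = K * trexp_mult n M D" by (simp add: TY sum_distrib_left mult_ac)
    finally show "(\<Sum>i<n. \<Sum>j<n. w i j * (exp (a i) * (a i - b j)\<^sup>2)) \<le> K * trexp_mult n M D" .
    have "(\<Sum>i<n. \<Sum>j<n. w i j * (exp (b j) * (a i - b j)\<^sup>2))
        = (\<Sum>j<n. exp (b j) * ip n (mv n D (v j)) (mv n D (v j)))"
      using DvDv by (subst sum.swap) (simp add: sum_distrib_left mult_ac)
    also have "\<dots> \<le> (\<Sum>j<n. exp (b j) * (K * ip n (v j) (mv n D (v j))))"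
      using K by (intro sum_mono mult_left_mono) auto
    also have "\<dots> = K * trexp_mult n M' D" by (simp add: TY' sum_distrib_left mult_ac)
    finally show "(\<Sum>i<n. \<Sum>j<n. w i j * (exp (b j) * (a i - b j)\<^sup>2)) \<le> K * trexp_mult n M' D" .
  qed
qed

text \<open>Convexity puts the integral of \<open>exp\<close> below its trapezoidal approximation.
  The bound is symmetric in the endpoints, which matters because eigenvalues of \<open>M\<close> and
  \<open>M - Y\<close> get compared in pairs of either order, even for positive semidefinite
  \<open>Y\<close>.\<close>

lemma exp_trapezoid_le:
  fixes x y :: real
  assumes "x \<le> y"
  shows "exp y - exp x \<le> (y - x) * (exp x + exp y) / 2"
proof -
  define f where "f d = d * (1 + exp d) / 2 - exp d + 1" for d :: real
  have "f 0 \<le> f (y - x)"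
  proof (rule DERIV_nonneg_imp_nondecreasing[of 0 "y - x" f])
    show "0 \<le> y - x" using assms by simp
    fix d :: real
    have "(f has_real_derivative (1 + exp d + d * exp d) / 2 - exp d) (at d)"
      unfolding f_def by (auto intro!: derivative_eq_intros)
    moreover have "(1 + exp d + d * exp d) / 2 - exp d \<ge> 0"
    proof -
      have "(1 - d) * exp d \<le> exp (- d) * exp d"
        using exp_ge_add_one_self[of "-d"] by (intro mult_right_mono) auto
      then show ?thesis by (simp add: exp_minus field_simps)
    qed
    ultimately show "\<exists>z. (f has_real_derivative z) (at d) \<and> 0 \<le> z" by blast
  qed
  then have "0 \<le> exp x * f (y - x)" by (simp add: f_def)
  also have "\<dots> = (y - x) * (exp x + exp y) / 2 - exp y + exp x"
    by (simp add: f_def algebra_simps exp_diff add_divide_distrib diff_divide_distrib)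
  finally show ?thesis by simp
qed

text \<open>Difference forms of f' = -g and g' >= -K g for the traces along the segment. The first
  is the tangent inequality \<open>1 + x \<le> exp x\<close>, the second the trapezoid bound, whose
  squares \<open>(a i - b j)\<^sup>2\<close> are absorbed by \<open>sq\<close>. The decrease is
  measured at the far end \<open>M'\<close>, where the second inequality supplies a lower
  bound.\<close>

lemma trexp_step:
  assumes M: "sym_mat n M" and Y: "sym_mat n Y"
    and sq: "\<And>x. ip n (mv n Y x) (mv n Y x) \<le> K * ip n x (mv n Y x)"
  defines "M' \<equiv> (\<lambda>k l. M k l - Y k l)"
  shows "trexp n M' \<le> trexp n M - trexp_mult n M' Y"
    and "(1 - K / 2) * trexp_mult n M Y \<le> (1 + K / 2) * trexp_mult n M' Y"
proof -
  have M': "sym_mat n M'" using M Y by (simp add: sym_mat_def M'_def)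
  obtain a b w where w: "\<And>i j. (0::real) \<le> w i j"
    and T: "trexp n M = (\<Sum>i<n. \<Sum>j<n. w i j * exp (a i))"
    "trexp n M' = (\<Sum>i<n. \<Sum>j<n. w i j * exp (b j))"
    and D: "trexp_mult n M Y = (\<Sum>i<n. \<Sum>j<n. w i j * (exp (a i) * (a i - b j)))"
    "trexp_mult n M' Y = (\<Sum>i<n. \<Sum>j<n. w i j * (exp (b j) * (a i - b j)))"
    and S: "(\<Sum>i<n. \<Sum>j<n. w i j * (exp (a i) * (a i - b j)\<^sup>2)) \<le> K * trexp_mult n M Y"
    "(\<Sum>i<n. \<Sum>j<n. w i j * (exp (b j) * (a i - b j)\<^sup>2)) \<le> K * trexp_mult n M' Y"
    by (rule trexp_joint[OF M M' _ sq]) (simp add: M'_def, blast)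
  have "trexp n M' + trexp_mult n M' Y
      = (\<Sum>i<n. \<Sum>j<n. w i j * (exp (b j) * (1 + (a i - b j))))"
    unfolding T D sum.distrib[symmetric] by (simp only: distrib_left mult_1_right)
  also have "\<dots> \<le> (\<Sum>i<n. \<Sum>j<n. w i j * (exp (b j) * exp (a i - b j)))"
    by (intro sum_mono mult_left_mono w exp_ge_add_one_self) auto
  also have "\<dots> = trexp n M" unfolding T by (simp add: exp_diff)
  finally show "trexp n M' \<le> trexp n M - trexp_mult n M' Y" by simp
  have "trexp_mult n M Y - trexp_mult n M' Y
      = (\<Sum>i<n. \<Sum>j<n. w i j * ((exp (a i) - exp (b j)) * (a i - b j)))"
    unfolding D sum_subtractf[symmetric]
    by (simp only: right_diff_distrib[of "w _ _", symmetric]) (simp only: left_diff_distrib)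
  also have "\<dots> \<le> (\<Sum>i<n. \<Sum>j<n. w i j * ((exp (a i) + exp (b j)) * (a i - b j)\<^sup>2 / 2))"
  proof (intro sum_mono mult_left_mono w)
    fix i j
    have *: "(exp x - exp y) * (x - y) \<le> (exp x + exp y) * (x - y)\<^sup>2 / 2" if "y \<le> x" for x y :: real
      using mult_right_mono[OF exp_trapezoid_le[OF that], of "x - y"] that
      by (simp add: power2_eq_square algebra_simps)
    show "(exp (a i) - exp (b j)) * (a i - b j) \<le> (exp (a i) + exp (b j)) * (a i - b j)\<^sup>2 / 2"
      using *[of "b j" "a i"] *[of "a i" "b j"]
      by (cases "b j \<le> a i") (simp_all add: power2_eq_square algebra_simps)
  qed
  also have "\<dots> = ((\<Sum>i<n. \<Sum>j<n. w i j * (exp (a i) * (a i - b j)\<^sup>2))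
       + (\<Sum>i<n. \<Sum>j<n. w i j * (exp (b j) * (a i - b j)\<^sup>2))) / 2"
    unfolding sum.distrib[symmetric] sum_divide_distrib
    by (simp only: distrib_left[symmetric] distrib_right[symmetric] times_divide_eq_right)
  also have "\<dots> \<le> (K * trexp_mult n M Y + K * trexp_mult n M' Y) / 2"
    using S by simp
  finally show "(1 - K / 2) * trexp_mult n M Y \<le> (1 + K / 2) * trexp_mult n M' Y"
    by (simp add: algebra_simps)
qed

text \<open>Splitting the decrement into \<open>m\<close> equal parts and letting \<open>m\<close> tend to infinity integrates
  \<open>trexp_step\<close> along the segment from \<open>M\<close> to \<open>M - Y\<close>.\<close>

theorem trexp_diff_le:
  assumes M: "sym_mat n M" and Y: "sym_mat n Y" and K: "K > 0"
    and sq: "\<And>x. ip n (mv n Y x) (mv n Y x) \<le> K * ip n x (mv n Y x)"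
  shows "trexp n (\<lambda>k l. M k l - Y k l) \<le> trexp n M - (1 - exp (-K)) / K * trexp_mult n M Y"
proof -
  \<comment> \<open>In one of \<open>m\<close> steps, with \<open>K / m\<close> for
    \<open>K\<close>, \<open>trexp_step\<close> lets the trace with \<open>Y\<close> shrink at most
    by this ratio. For \<open>m > K\<close> the ratio is positive, so the bounds of successive steps
    multiply.\<close>
  define \<rho> where "\<rho> m = (1 - K / (2 * real m)) / (1 + K / (2 * real m))" for m
  define p where "p = trexp_mult n M Y"
  have bound: "trexp n (\<lambda>k l. M k l - Y k l)
      \<le> trexp n M - (1 - K / (2 * real m)) * (1 - \<rho> m ^ m) / K * p"
    if m: "real m > K" for m
  proof -
    have m0: "real m > 0" using m K by simp
    define N where "N i = (\<lambda>k l. M k l - real i / real m * Y k l)" for i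
    define Z where "Z = (\<lambda>k l. 1 / real m * Y k l)"
    have NS: "N (Suc i) = (\<lambda>k l. N i k l - Z k l)" for i
      by (simp add: N_def Z_def fun_eq_iff add_divide_distrib algebra_simps)
    have N: "sym_mat n (N i)" for i using M Y by (simp add: sym_mat_def N_def)
    have Zs: "sym_mat n Z" using Y by (simp add: sym_mat_def Z_def)
    have Zsq: "ip n (mv n Z x) (mv n Z x) \<le> K / real m * ip n x (mv n Z x)" for x
    proof -
      have "mv n Z x = (\<lambda>k. 1 / real m * mv n Y x k)" unfolding Z_def by (rule mv_linear)
      then show ?thesis using mult_left_mono[OF sq[of x], of "1 / real m * (1 / real m)"]
        by (simp only: ip_scale_left ip_scale_right) (simp add: mult_ac)
    qed
    have ZY: "trexp_mult n M' Z = trexp_mult n M' Y / real m" for M'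
      using trexp_mult_linear(1)[of n M' "1 / real m" Y] by (simp add: Z_def)
    have r: "0 \<le> \<rho> m" "\<rho> m < 1" unfolding \<rho>_def using m m0 K by (simp_all add: divide_less_eq divide_le_eq add_pos_pos)
    have step: "trexp n (N (Suc i)) \<le> trexp n (N i) - trexp_mult n (N (Suc i)) Y / real m"
      "\<rho> m * trexp_mult n (N i) Y \<le> trexp_mult n (N (Suc i)) Y" for i
    proof -
      note s = trexp_step[OF N Zs Zsq, of i, folded NS, unfolded ZY]
      show "trexp n (N (Suc i)) \<le> trexp n (N i) - trexp_mult n (N (Suc i)) Y / real m"
        by (rule s(1))
      have "(1 - K / (2 * real m)) * trexp_mult n (N i) Y
          \<le> (1 + K / (2 * real m)) * trexp_mult n (N (Suc i)) Y"
        using mult_left_mono[OF s(2), of "real m"] m0 by (simp add: mult_ac)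
      moreover have "1 + K / (2 * real m) > 0" using K m0 by (simp add: add_pos_pos)
      ultimately show "\<rho> m * trexp_mult n (N i) Y \<le> trexp_mult n (N (Suc i)) Y"
        by (simp add: \<rho>_def pos_divide_le_eq mult_ac)
    qed
    have N0: "N 0 = M" by (simp add: N_def)
    have geo: "\<rho> m ^ i * p \<le> trexp_mult n (N i) Y" for i
    proof (induction i)
      case (Suc i)
      have "\<rho> m ^ Suc i * p \<le> \<rho> m * trexp_mult n (N i) Y"
        using mult_left_mono[OF Suc r(1)] by (simp add: mult_ac)
      then show ?case using step(2)[of i] by simp
    qed (simp add: p_def N0)
    have "trexp n (N i) \<le> trexp n M - (\<Sum>j<i. \<rho> m ^ Suc j * p / real m)" for i
    proof (induction i)
      case (Suc i)
      have "\<rho> m ^ Suc i * p / real m \<le> trexp_mult n (N (Suc i)) Y / real m"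
        using geo[of "Suc i"] m0 by (intro divide_right_mono) simp_all
      then show ?case using step(1)[of i] Suc by simp
    qed (simp add: N0)
    from this[of m] have "trexp n (N m) \<le> trexp n M - (\<Sum>j<m. \<rho> m ^ j) * \<rho> m * p / real m"
      by (simp add: sum_distrib_right sum_distrib_left sum_divide_distrib mult_ac)
    also have "(\<Sum>j<m. \<rho> m ^ j) = (1 - \<rho> m ^ m) / (1 - \<rho> m)"
      using r by (simp add: geometric_sum divide_simps) (simp add: algebra_simps)
    also have "\<dots> * \<rho> m * p / real m = (1 - \<rho> m ^ m) * (\<rho> m / (1 - \<rho> m)) / real m * p"
      by simp
    \<comment> \<open>Here the step length \<open>1 / real m\<close> cancels and the denominator
      \<open>K\<close> of the limit appears.\<close>
    also have "\<rho> m / (1 - \<rho> m) = (1 - K / (2 * real m)) * real m / K"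
    proof -
      define e where "e = 1 + K / (2 * real m)"
      have e: "e > 0" using K m0 by (simp add: add_pos_pos e_def)
      have "1 - \<rho> m = (e - (1 - K / (2 * real m))) / e"
        using e by (simp add: \<rho>_def e_def[symmetric] diff_divide_distrib)
      also have "e - (1 - K / (2 * real m)) = K / real m" by (simp add: e_def)
      finally have "\<rho> m / (1 - \<rho> m) = ((1 - K / (2 * real m)) / e) / (K / real m / e)"
        by (simp add: \<rho>_def e_def)
      also have "\<dots> = (1 - K / (2 * real m)) / (K / real m)" using e by simp
      finally show ?thesis by simp
    qed
    finally show ?thesis using m0 by (simp add: N_def mult_ac)
  qed
  have lim: "(\<lambda>m. trexp n M - (1 - K / (2 * real m)) * (1 - \<rho> m ^ m) / K * p)
      \<longlonglongrightarrow> trexp n M - (1 - 0) * (1 - exp (-K)) / K * p"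
  proof -
    have "(\<lambda>m. (1 + (-K/2) / real m) ^ m / (1 + (K/2) / real m) ^ m) \<longlonglongrightarrow> exp (-K/2) / exp (K/2)"
      by (intro tendsto_divide tendsto_exp_limit_sequentially) auto
    also have "(\<lambda>m. (1 + (-K/2) / real m) ^ m / (1 + (K/2) / real m) ^ m) = (\<lambda>m. \<rho> m ^ m)"
      by (simp add: \<rho>_def power_divide)
    also have "exp (-K/2) / exp (K/2) = exp (-K)"
      by (simp add: exp_diff[symmetric])
    finally have "(\<lambda>m. \<rho> m ^ m) \<longlonglongrightarrow> exp (-K)" .
    moreover have "(\<lambda>m. K / (2 * real m)) \<longlonglongrightarrow> 0" by real_asymp
    ultimately show ?thesis by (intro tendsto_intros) (use K in auto)
  qed
  have "\<forall>\<^sub>F m in sequentially. K < real m"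
    using filterlim_real_sequentially by (simp add: filterlim_at_top_dense)
  then have "\<forall>\<^sub>F m in sequentially. trexp n (\<lambda>k l. M k l - Y k l)
      \<le> trexp n M - (1 - K / (2 * real m)) * (1 - \<rho> m ^ m) / K * p"
    by eventually_elim (rule bound)
  from tendsto_lowerbound[OF lim this] show ?thesis by (simp add: p_def)
qed

subsection \<open>A matrix Chernoff bound\<close>

lemma finite_set_Pi_pmf:
  assumes "finite A" "\<And>x. x \<in> A \<Longrightarrow> finite (set_pmf (q x))"
  shows "finite (set_pmf (Pi_pmf A d q))"
  using assms by (simp add: set_Pi_pmf finite_PiE_dflt)

text \<open>Conditions on all draws but the one at \<open>x\<close>, so that the inductions below
  integrate a single draw against a fixed remainder.\<close>

lemma expectation_Pi_pmf_insert:
  fixes F :: "('a \<Rightarrow> 'b) \<Rightarrow> real"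
  assumes A: "finite A" "x \<notin> A" and q: "finite (set_pmf q)"
  shows "measure_pmf.expectation (Pi_pmf (insert x A) d (\<lambda>_. q)) F
       = measure_pmf.expectation (Pi_pmf A d (\<lambda>_. q))
           (\<lambda>\<xi>. measure_pmf.expectation q (\<lambda>y. F (\<xi>(x := y))))"
proof -
  let ?P = "Pi_pmf A d (\<lambda>_. q)"
  have fin: "finite (set_pmf ?P)" using A q by (intro finite_set_Pi_pmf) auto
  have "Pi_pmf (insert x A) d (\<lambda>_. q) = ?P \<bind> (\<lambda>\<xi>. map_pmf (\<lambda>y. \<xi>(x := y)) q)"
    using A by (simp add: Pi_pmf_insert' bind_commute_pmf[of q] map_pmf_def)
  then have "measure_pmf.expectation (Pi_pmf (insert x A) d (\<lambda>_. q)) F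
      = (\<Sum>\<xi>\<in>set_pmf ?P. pmf ?P \<xi> *\<^sub>R measure_pmf.expectation (map_pmf (\<lambda>y. \<xi>(x := y)) q) F)"
    using fin q by (simp add: pmf_expectation_bind[of "set_pmf ?P"])
  also have "\<dots> = measure_pmf.expectation ?P (\<lambda>\<xi>. measure_pmf.expectation q (\<lambda>y. F (\<xi>(x := y))))"
    using fin by (subst integral_measure_pmf[of "set_pmf ?P"]) auto
  finally show ?thesis .
qed

lemma expectation_Pi_pmf_sum_sq:
  fixes f :: "'b \<Rightarrow> real"
  assumes A: "finite A" and q: "finite (set_pmf q)" and f: "measure_pmf.expectation q f = 0"
  shows "measure_pmf.expectation (Pi_pmf A d (\<lambda>_. q)) (\<lambda>\<xi>. (\<Sum>j\<in>A. f (\<xi> j))\<^sup>2)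
       = real (card A) * measure_pmf.expectation q (\<lambda>y. (f y)\<^sup>2)"
  using A
proof (induction A rule: finite_induct)
  case (insert x A)
  note [simp] = integrable_measure_pmf_finite[OF q]
    integrable_measure_pmf_finite[OF finite_set_Pi_pmf[OF insert(1) q]]
  have "measure_pmf.expectation q (\<lambda>y. (f y + s)\<^sup>2) = measure_pmf.expectation q (\<lambda>y. (f y)\<^sup>2) + s\<^sup>2" for s
    using f by (simp add: power2_sum)
  moreover have "(\<Sum>j\<in>insert x A. f ((\<xi>(x := y)) j)) = f y + (\<Sum>j\<in>A. f (\<xi> j))" for \<xi> y
    using insert by (subst sum.insert) (auto intro!: sum.cong)
  ultimately show ?case
    using insert by (simp only: expectation_Pi_pmf_insert[OF insert(1,2) q]) (simp add: algebra_simps)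
qed simp

text \<open>\<open>g\<close> cancels the mean of the sum, so the left side is the variance of a sum
  of independent terms, and each variance is at most the second moment.\<close>

lemma expectation_Pi_pmf_sum_sq_centered_le:
  fixes h :: "'b \<Rightarrow> real"
  assumes A: "finite A" and q: "finite (set_pmf q)"
    and g: "g = - real (card A) * measure_pmf.expectation q h"
  shows "measure_pmf.expectation (Pi_pmf A d (\<lambda>_. q)) (\<lambda>\<xi>. (g + (\<Sum>j\<in>A. h (\<xi> j)))\<^sup>2)
       \<le> real (card A) * measure_pmf.expectation q (\<lambda>y. (h y)\<^sup>2)"
proof -
  note [simp] = integrable_measure_pmf_finite[OF q]
  define m where "m = measure_pmf.expectation q h"
  have "g + (\<Sum>j\<in>A. h (\<xi> j)) = (\<Sum>j\<in>A. h (\<xi> j) - m)" for \<xi>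
    by (simp add: g m_def sum_subtractf)
  moreover have "measure_pmf.expectation q (\<lambda>y. h y - m) = 0" by (simp add: m_def)
  ultimately have "measure_pmf.expectation (Pi_pmf A d (\<lambda>_. q)) (\<lambda>\<xi>. (g + (\<Sum>j\<in>A. h (\<xi> j)))\<^sup>2)
      = real (card A) * measure_pmf.expectation q (\<lambda>y. (h y - m)\<^sup>2)"
    using expectation_Pi_pmf_sum_sq[OF A q, of "\<lambda>y. h y - m"] by simp
  also have "measure_pmf.expectation q (\<lambda>y. (h y - m)\<^sup>2) = measure_pmf.expectation q (\<lambda>y. (h y)\<^sup>2) - m\<^sup>2"
    by (simp add: power2_diff m_def[symmetric]) (simp add: power2_eq_square)
  also have "\<dots> \<le> measure_pmf.expectation q (\<lambda>y. (h y)\<^sup>2)" by simp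
  finally show ?thesis by (simp add: mult_left_mono)
qed

text \<open>Since the mean of \<open>Y\<close> is the scalar \<open>\<mu>\<close>, the mean of
  \<open>trexp_mult n M (Y y)\<close> is \<open>\<mu> * trexp n M\<close>. The recursion over the
  draws thus closes in \<open>trexp\<close> alone, and every draw contributes the same
  factor.\<close>

lemma expectation_trexp_le:
  fixes Y :: "'b \<Rightarrow> nat \<Rightarrow> nat \<Rightarrow> real"
  assumes A: "finite A" and q: "finite (set_pmf q)" and Y: "\<And>i. sym_mat n (Y i)" and K: "K > 0"
    and sq: "\<And>i x. i \<in> set_pmf q \<Longrightarrow> ip n (mv n (Y i) x) (mv n (Y i) x) \<le> K * ip n x (mv n (Y i) x)"
    and mean: "\<And>k l. k < n \<Longrightarrow> l < n \<Longrightarrow> measure_pmf.expectation q (\<lambda>i. Y i k l) = (if k = l then \<mu> else 0)"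
  shows "measure_pmf.expectation (Pi_pmf A d (\<lambda>_. q)) (\<lambda>\<xi>. trexp n (\<lambda>k l. - (\<Sum>j\<in>A. Y (\<xi> j) k l)))
      \<le> real n * exp (- (real (card A) * ((1 - exp (-K)) / K * \<mu>)))"
  using A
proof (induction A rule: finite_induct)
  case empty
  then show ?case by (simp add: trexp_zero)
next
  case (insert x A)
  let ?P = "Pi_pmf A d (\<lambda>_. q)" and ?c = "(1 - exp (-K)) / K"
  let ?M = "\<lambda>\<xi> k l. - (\<Sum>j\<in>A. Y (\<xi> j) k l)"
  note [simp] = integrable_measure_pmf_finite[OF q]
    integrable_measure_pmf_finite[OF finite_set_Pi_pmf[OF insert(1) q]]
  have step: "measure_pmf.expectation q (\<lambda>y. trexp n (\<lambda>k l. M k l - Y y k l)) \<le> trexp n M * exp (- (?c * \<mu>))"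
    if M: "sym_mat n M" for M
  proof -
    have "measure_pmf.expectation q (\<lambda>y. trexp_mult n M (Y y))
        = (\<Sum>y\<in>set_pmf q. pmf q y * trexp_mult n M (Y y))"
      using q by (subst integral_measure_pmf[of "set_pmf q"]) auto
    also have "\<dots> = trexp_mult n M (\<lambda>k l. \<Sum>y\<in>set_pmf q. pmf q y * Y y k l)"
      by (simp add: trexp_mult_linear)
    also have "\<dots> = \<mu> * trexp n M"
    proof (rule trexp_mult_scalar[OF M])
      fix k l assume kl: "k < n" "l < n"
      have "(\<Sum>y\<in>set_pmf q. pmf q y * Y y k l) = measure_pmf.expectation q (\<lambda>i. Y i k l)"
        using q by (subst integral_measure_pmf[of "set_pmf q"]) auto
      then show "(\<Sum>y\<in>set_pmf q. pmf q y * Y y k l) = (if k = l then \<mu> else 0)"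
        using mean[OF kl] by simp
    qed
    finally have E: "measure_pmf.expectation q (\<lambda>y. trexp_mult n M (Y y)) = \<mu> * trexp n M" .
    have "measure_pmf.expectation q (\<lambda>y. trexp n (\<lambda>k l. M k l - Y y k l))
        \<le> measure_pmf.expectation q (\<lambda>y. trexp n M - ?c * trexp_mult n M (Y y))"
      using trexp_diff_le[OF M Y K sq] by (intro integral_mono_AE) (auto simp: AE_measure_pmf_iff)
    also have "\<dots> = trexp n M * (1 + - (?c * \<mu>))"
      by (simp add: E algebra_simps)
    also have "\<dots> \<le> trexp n M * exp (- (?c * \<mu>))"
      by (intro mult_left_mono exp_ge_add_one_self trexp_nonneg)
    finally show ?thesis .
  qed
  have upd: "(\<lambda>k l. - (\<Sum>j\<in>insert x A. Y ((\<xi>(x := y)) j) k l)) = (\<lambda>k l. ?M \<xi> k l - Y y k l)" for \<xi> y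
  proof (intro ext)
    fix k l
    have "(\<Sum>j\<in>A. Y ((\<xi>(x := y)) j) k l) = (\<Sum>j\<in>A. Y (\<xi> j) k l)"
      using insert by (intro sum.cong) auto
    then show "- (\<Sum>j\<in>insert x A. Y ((\<xi>(x := y)) j) k l) = ?M \<xi> k l - Y y k l"
      using insert by simp
  qed
  have M: "sym_mat n (?M \<xi>)" for \<xi>
    using Y by (auto simp: sym_mat_def intro!: sum.cong)
  have "measure_pmf.expectation (Pi_pmf (insert x A) d (\<lambda>_. q))
        (\<lambda>\<xi>. trexp n (\<lambda>k l. - (\<Sum>j\<in>insert x A. Y (\<xi> j) k l)))
      = measure_pmf.expectation ?P (\<lambda>\<xi>. measure_pmf.expectation q (\<lambda>y. trexp n (\<lambda>k l. ?M \<xi> k l - Y y k l)))"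
    by (simp only: expectation_Pi_pmf_insert[OF insert(1,2) q] upd)
  also have "\<dots> \<le> measure_pmf.expectation ?P (\<lambda>\<xi>. trexp n (?M \<xi>) * exp (- (?c * \<mu>)))"
    using step[OF M] by (intro integral_mono) auto
  also have "\<dots> = measure_pmf.expectation ?P (\<lambda>\<xi>. trexp n (?M \<xi>)) * exp (- (?c * \<mu>))"
    by simp
  also have "\<dots> \<le> real n * exp (- (real (card A) * (?c * \<mu>))) * exp (- (?c * \<mu>))"
    by (intro mult_right_mono insert.IH) auto
  also have "\<dots> = real n * exp (- (real (card (insert x A)) * (?c * \<mu>)))"
  proof -
    have "real (card (insert x A)) = 1 + real (card A)" using insert by simp
    then show ?thesis
      by (simp only: mult.assoc exp_add[symmetric] distrib_right minus_add_distrib mult_1_left add.commute)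
  qed
  finally show ?case .
qed

text \<open>Laplace transform method: a unit vector with form at most \<open>c\<close> forces the
  trace of the exponential of minus the sum up to \<open>exp (-c)\<close>, and Markov's inequality
  applies. The usual free parameter is absorbed into the scale of \<open>Y\<close>, hence into
  \<open>K\<close>, \<open>\<mu>\<close> and \<open>c\<close>.\<close>

theorem matrix_chernoff_lower:
  fixes Y :: "'b \<Rightarrow> nat \<Rightarrow> nat \<Rightarrow> real"
  assumes A: "finite A" and q: "finite (set_pmf q)" and Y: "\<And>i. sym_mat n (Y i)" and K: "K > 0"
    and sq: "\<And>i x. i \<in> set_pmf q \<Longrightarrow> ip n (mv n (Y i) x) (mv n (Y i) x) \<le> K * ip n x (mv n (Y i) x)"
    and mean: "\<And>k l. k < n \<Longrightarrow> l < n \<Longrightarrow> measure_pmf.expectation q (\<lambda>i. Y i k l) = (if k = l then \<mu> else 0)"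
  shows "measure_pmf.prob (Pi_pmf A d (\<lambda>_. q))
      {\<xi>. \<exists>x. ip n x x = 1 \<and> ip n x (mv n (\<lambda>k l. \<Sum>j\<in>A. Y (\<xi> j) k l) x) \<le> c}
      \<le> real n * exp (c - real (card A) * ((1 - exp (-K)) / K * \<mu>))"
proof -
  let ?P = "Pi_pmf A d (\<lambda>_. q)"
  let ?E = "{\<xi>. \<exists>x. ip n x x = 1 \<and> ip n x (mv n (\<lambda>k l. \<Sum>j\<in>A. Y (\<xi> j) k l) x) \<le> c}"
  let ?M = "\<lambda>\<xi> k l. - (\<Sum>j\<in>A. Y (\<xi> j) k l)"
  note [simp] = integrable_measure_pmf_finite[OF finite_set_Pi_pmf[OF A q]]
  have "exp (-c) * indicator ?E \<xi> \<le> trexp n (?M \<xi>)" for \<xi>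
  proof (cases "\<xi> \<in> ?E")
    case True
    then obtain x where x: "ip n x x = 1" "ip n x (mv n (\<lambda>k l. \<Sum>j\<in>A. Y (\<xi> j) k l) x) \<le> c" by blast
    have "sym_mat n (?M \<xi>)" using Y by (auto simp: sym_mat_def intro!: sum.cong)
    moreover have "ip n x (mv n (?M \<xi>) x) = - ip n x (mv n (\<lambda>k l. \<Sum>j\<in>A. Y (\<xi> j) k l) x)"
      by (simp add: ip_def mv_def sum_negf)
    ultimately have "exp (- ip n x (mv n (\<lambda>k l. \<Sum>j\<in>A. Y (\<xi> j) k l) x)) \<le> trexp n (?M \<xi>)"
      using trexp_ge_exp_quadratic[of n "?M \<xi>" x] x(1) by simp
    moreover have "exp (-c) \<le> exp (- ip n x (mv n (\<lambda>k l. \<Sum>j\<in>A. Y (\<xi> j) k l) x))" using x(2) by simp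
    ultimately have "exp (-c) \<le> trexp n (?M \<xi>)" by (rule order_trans[rotated])
    then show ?thesis using True by simp
  qed (simp add: trexp_nonneg)
  then have "measure_pmf.expectation ?P (\<lambda>\<xi>. exp (-c) * indicator ?E \<xi>)
      \<le> measure_pmf.expectation ?P (\<lambda>\<xi>. trexp n (?M \<xi>))"
    by (intro integral_mono) auto
  also have "\<dots> \<le> real n * exp (- (real (card A) * ((1 - exp (-K)) / K * \<mu>)))"
    by (rule expectation_trexp_le[OF A q Y K sq mean])
  also have "measure_pmf.expectation ?P (\<lambda>\<xi>. exp (-c) * indicator ?E \<xi>) = exp (-c) * measure_pmf.prob ?P ?E"
    by simp
  finally have "exp c * (exp (-c) * measure_pmf.prob ?P ?E)
      \<le> exp c * (real n * exp (- (real (card A) * ((1 - exp (-K)) / K * \<mu>))))"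
    by (intro mult_left_mono) auto
  then show ?thesis by (simp add: exp_minus exp_diff field_simps)
qed

subsection \<open>Sampling rows with orthonormal columns\<close>

lemma ip_cauchy_schwarz: "(ip n x y)\<^sup>2 \<le> ip n x x * ip n y y"
  using Cauchy_Schwarz_ineq_sum[of x y "{..<n}"] by (simp add: ip_def power2_eq_square)

text \<open>Positivity of \<open>Y\<close> at \<open>x - Yx/K\<close> turns \<open>0 \<le> Y \<le> K\<close> into \<open>Y\<^sup>2 \<le> K Y\<close>.\<close>

lemma psd_square_le:
  assumes Y: "sym_mat n Y" and K: "K > 0"
    and pos: "\<And>x. 0 \<le> ip n x (mv n Y x)" and le: "\<And>x. ip n x (mv n Y x) \<le> K * ip n x x"
  shows "ip n (mv n Y x) (mv n Y x) \<le> K * ip n x (mv n Y x)"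
proof -
  define y where "y = mv n Y x"
  have yx: "ip n y y = ip n x (mv n Y y)" using sym_matD[OF Y, of x y] by (simp add: y_def)
  have "0 \<le> ip n (\<lambda>k. K * x k - y k) (mv n Y (\<lambda>k. K * x k - y k))" by (rule pos)
  also have "\<dots> = K * K * ip n x y - 2 * K * ip n y y + ip n y (mv n Y y)"
    by (simp add: mv_linear ip_diff_left ip_diff_right ip_scale_left ip_scale_right y_def[symmetric]
        yx[symmetric] algebra_simps)
  also have "\<dots> \<le> K * K * ip n x y - K * ip n y y" using le[of y] by simp
  also have "\<dots> = K * (K * ip n x y - ip n y y)" by (simp add: algebra_simps)
  finally show ?thesis using K by (simp add: zero_le_mult_iff y_def)
qed

lemma ip_rank_one: "ip n x (mv n (\<lambda>k l. c * (u k * u l)) x) = c * (ip n u x)\<^sup>2"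
  by (simp add: ip_def mv_def sum_distrib_left power2_eq_square sum_product mult_ac)

text \<open>Markov's inequality in a form that survives the threshold 0, which occurs when the
  optimal residual vanishes: then the expectation is 0 and \<open>F\<close> vanishes on the
  support.\<close>

lemma prob_gt_le:
  fixes F :: "'a \<Rightarrow> real"
  assumes fin: "finite (set_pmf P)" and F: "\<And>x. 0 \<le> F x" and b: "b \<ge> 0" and a: "0 \<le> a"
    and E: "measure_pmf.expectation P F \<le> b * a"
  shows "measure_pmf.prob P {x. F x > a} \<le> b"
proof -
  note [simp] = integrable_measure_pmf_finite[OF fin]
  show ?thesis
  proof (cases "a = 0")
    case True
    have "measure_pmf.expectation P F = 0"
      using E True F by (simp add: antisym integral_nonneg_AE)
    then have "AE x in measure_pmf P. F x = 0"
      using F by (subst (asm) integral_nonneg_eq_0_iff_AE) auto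
    then have "set_pmf P \<inter> {x. F x > a} = {}" using True by (auto simp: AE_measure_pmf_iff)
    then have "measure_pmf.prob P {x. F x > a} = 0" by (simp only: measure_pmf_zero_iff)
    then show ?thesis using b by simp
  next
    case False
    have "a * indicator {x. F x > a} x \<le> F x" for x using F by (auto simp: indicator_def)
    then have "measure_pmf.expectation P (\<lambda>x. a * indicator {x. F x > a} x) \<le> measure_pmf.expectation P F"
      by (intro integral_mono) auto
    then have "a * measure_pmf.prob P {x. F x > a} \<le> a * b" using E by (simp add: mult.commute)
    then show ?thesis using False a by simp
  qed
qed

text \<open>\<open>u i\<close> is the \<open>i\<close>th row of a matrix with orthonormal columns, \<open>D\<close> the deterministic index set and
  \<open>c i\<close> the squared rescaling factor of the \<open>i\<close>th row when it is sampled; \<open>c i = 0\<close> if it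
  cannot be.\<close>

locale leverage_sampling =
  fixes N r m :: nat and u :: "nat \<Rightarrow> nat \<Rightarrow> real" and p :: "nat \<Rightarrow> real" and D :: "nat set"
    and \<beta> pd :: real and q :: "nat pmf"
  assumes orth: "\<And>k l. k < r \<Longrightarrow> l < r \<Longrightarrow> (\<Sum>i<N. u i k * u i l) = (if k = l then 1 else 0)"
    and r: "r > 0" and m: "m > 0" and \<beta>: "\<beta> > 0"
    and p_sum: "(\<Sum>i<N. p i) = 1"
    and D: "D \<subseteq> {..<N}" and pd: "pd = (\<Sum>i\<in>D. p i)" "pd < 1"
    and lev: "\<And>i. i < N \<Longrightarrow> \<beta> * ip r (u i) (u i) / real r \<le> p i"
    and q: "\<And>i. pmf q i = (if i < N \<and> i \<notin> D then p i / (1 - pd) else 0)"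
begin

text \<open>Bounds the ratio of a squared row norm to the probability of drawing that row
  (\<open>row_norm_le\<close>), and is the unit in which \<open>sample_good\<close> measures the
  number of draws.\<close>

definition \<kappa> where "\<kappa> = (1 - pd) * (real r / \<beta>)"

definition c where "c i = 1 / (real m * pmf q i)"

lemma kappa_pos: "\<kappa> > 0"
  using r \<beta> pd(2) by (simp add: \<kappa>_def)

lemma c_nonneg: "c i \<ge> 0"
  by (simp add: c_def)

lemma set_q: "set_pmf q \<subseteq> {..<N} - D"
  by (auto simp: set_pmf_eq q)

lemma finite_q: "finite (set_pmf q)"
  using set_q by (rule finite_subset) simp

lemma expectation_q: "measure_pmf.expectation q f = (\<Sum>i\<in>{..<N} - D. pmf q i * f i)" for f :: "nat \<Rightarrow> real"
  using set_q by (subst integral_measure_pmf[of "{..<N} - D"]) auto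

lemma split_sum: "(\<Sum>i<N. f i) = (\<Sum>i\<in>D. f i) + (\<Sum>i\<in>{..<N} - D. f i)" for f :: "nat \<Rightarrow> real"
  using D by (subst sum.subset_diff[of D]) auto

text \<open>A row outside \<open>D\<close> that is never drawn has leverage score 0. The weight
  \<open>c i = 0\<close> therefore loses nothing there, and the sampled sums stay unbiased
  (\<open>q_times_c\<close>).\<close>

lemma row_zero:
  assumes "i \<in> {..<N} - D" "pmf q i = 0" "k < r"
  shows "u i k = 0"
proof -
  have "p i = 0" using assms pd by (simp add: q)
  then have "ip r (u i) (u i) \<le> 0" using lev[of i] assms(1) r \<beta> by (simp add: divide_le_0_iff mult_le_0_iff)
  then show ?thesis using ip_self_nonneg[of r "u i"] ip_self_eq_0[of r "u i"] assms(3) by simp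
qed

lemma q_times_c:
  assumes "i \<in> {..<N} - D" "k < r"
  shows "pmf q i * (c i * u i k) = u i k / real m"
  using row_zero[OF assms(1) _ assms(2)] m by (cases "pmf q i = 0") (simp_all add: c_def)

lemma row_norm_le:
  assumes "i \<in> {..<N} - D"
  shows "ip r (u i) (u i) \<le> \<kappa> * pmf q i"
proof -
  have "ip r (u i) (u i) \<le> real r / \<beta> * p i"
    using lev[of i] assms r \<beta> by (simp add: field_simps)
  also have "\<dots> = \<kappa> * pmf q i" using assms pd(2) by (simp add: \<kappa>_def q)
  finally show ?thesis .
qed

lemma c_row_norm_le:
  assumes "i \<in> {..<N} - D"
  shows "c i * ip r (u i) (u i) \<le> \<kappa> / real m"
proof (cases "pmf q i = 0")
  case False
  have "c i * ip r (u i) (u i) \<le> c i * (\<kappa> * pmf q i)"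
    using row_norm_le[OF assms] by (intro mult_left_mono c_nonneg)
  then show ?thesis using False by (simp add: c_def)
qed (use kappa_pos in \<open>simp add: c_def\<close>)

lemma sum_rows_sq: "(\<Sum>i<N. (ip r (u i) x)\<^sup>2) = ip r x x"
proof -
  have "(\<Sum>i<N. (ip r (u i) x)\<^sup>2) = (\<Sum>i<N. \<Sum>k<r. \<Sum>l<r. x k * x l * (u i k * u i l))"
    by (simp add: ip_def power2_eq_square sum_product mult_ac)
  also have "\<dots> = (\<Sum>k<r. \<Sum>l<r. \<Sum>i<N. x k * x l * (u i k * u i l))"
    by (subst sum.swap, rule sum.cong[OF refl], subst sum.swap, simp)
  also have "\<dots> = (\<Sum>k<r. \<Sum>l<r. x k * x l * (if k = l then 1 else 0))"
    using orth by (simp add: sum_distrib_left[symmetric])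
  also have "\<dots> = ip r x x"
    by (simp add: ip_def if_distrib[of "\<lambda>c. _ * c"] cong: if_cong)
  finally show ?thesis .
qed

text \<open>Orthonormality gives the bound 1, and Cauchy-Schwarz with \<open>row_norm_le\<close>
  gives \<open>\<kappa>\<close>, as the probabilities sum to 1. The latter can be smaller when
  \<open>D\<close> carries most of the probability; the minimum keeps the remainder
  \<open>min 1 \<kappa> - L\<close> within norm \<open>\<kappa>\<close>.\<close>

lemma rest_le:
  "(\<Sum>i\<in>{..<N} - D. (ip r (u i) x)\<^sup>2) \<le> min 1 \<kappa> * ip r x x"
proof -
  have "(\<Sum>i\<in>{..<N} - D. (ip r (u i) x)\<^sup>2) \<le> (\<Sum>i\<in>{..<N} - D. \<kappa> * pmf q i * ip r x x)"
    using row_norm_le ip_cauchy_schwarz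
    by (intro sum_mono) (meson ip_self_nonneg mult_right_mono order_trans)
  also have "\<dots> = \<kappa> * (\<Sum>i\<in>{..<N} - D. pmf q i) * ip r x x"
    by (simp add: sum_distrib_left sum_distrib_right)
  also have "(\<Sum>i\<in>{..<N} - D. pmf q i) = 1" using set_q by (simp add: sum_pmf_eq_1)
  finally have "(\<Sum>i\<in>{..<N} - D. (ip r (u i) x)\<^sup>2) \<le> \<kappa> * ip r x x" by simp
  moreover have "(\<Sum>i\<in>{..<N} - D. (ip r (u i) x)\<^sup>2) \<le> ip r x x"
    using split_sum[of "\<lambda>i. (ip r (u i) x)\<^sup>2"] sum_rows_sq[of x]
      sum_nonneg[of D "\<lambda>i. (ip r (u i) x)\<^sup>2"] by simp
  ultimately show ?thesis by (simp add: min_def)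
qed

section \<open>The smallest eigenvalue of the sketched Gram matrix\<close>

abbreviation sample :: "(nat \<Rightarrow> nat) pmf" where
  "sample \<equiv> Pi_pmf {..<m} 0 (\<lambda>_. q)"

text \<open>The squared norm of \<open>S U x\<close>.\<close>

definition sketch_quad :: "(nat \<Rightarrow> nat) \<Rightarrow> (nat \<Rightarrow> real) \<Rightarrow> real" where
  "sketch_quad \<xi> x = (\<Sum>i\<in>D. (ip r (u i) x)\<^sup>2) + (\<Sum>j<m. c (\<xi> j) * (ip r (u (\<xi> j)) x)\<^sup>2)"

text \<open>The deterministic part \<open>I - L\<close> of the sketched Gram matrix is not a multiple of the identity. Its
  scalar part \<open>1 - min 1 \<kappa>\<close> is set aside and the positive semidefinite remainder
  \<open>min 1 \<kappa> - L\<close> is distributed evenly over the \<open>m\<close> random summands, which makes their mean scalar while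
  at most doubling the bound \<open>\<kappa> / m\<close> on their norm.\<close>

lemma prob_sketch_quad_le:
  "measure_pmf.prob sample {\<xi>. \<exists>x. ip r x x = 1 \<and> sketch_quad \<xi> x \<le> 1 / sqrt 2}
    \<le> real r * exp (- (1 - 1 / sqrt 2 - ln 2 / (2 * sqrt 2)) * (real m / (2 * \<kappa>)))"
proof -
  \<comment> \<open>Up to the factor \<open>m / (2 * \<kappa>)\<close>, the exponent obtained for
    \<open>\<kappa>' = 1\<close> is \<open>K / sqrt 2 - (1 - exp (- K))\<close>; it is minimal where
    \<open>exp (- K) = 1 / sqrt 2\<close>. The scale \<open>t\<close> turns the norm bound
    \<open>2 * \<kappa> / m\<close> of the unscaled summands into \<open>K\<close>.\<close>
  define K :: real where "K = ln 2 / 2"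
  define t where "t = K * (real m / (2 * \<kappa>))"
  define \<kappa>' where "\<kappa>' = min 1 \<kappa>"
  define R where "R = {..<N} - D"
  define Q where "Q k l = \<kappa>' * (if k = l then 1 else 0) - (\<Sum>i\<in>R. u i k * u i l)" for k l
  define Y where "Y i k l = t * (c i * (u i k * u i l) + 1 / real m * Q k l)" for i k l
  have K: "K > 0" by (simp add: K_def)
  have t: "t > 0" using K m kappa_pos by (simp add: t_def)
  have Ysym: "sym_mat r (Y i)" for i
    by (auto simp: sym_mat_def Y_def Q_def mult_ac intro!: sum.cong)
  have Qquad: "ip r x (mv r Q x) = \<kappa>' * ip r x x - (\<Sum>i\<in>R. (ip r (u i) x)\<^sup>2)" for x
  proof -
    have "mv r (\<lambda>k l. \<kappa>' * (if k = l then 1 else 0)) x k = \<kappa>' * x k" if "k < r" for k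
      using that by (simp add: mv_def if_distrib[of "\<lambda>c. _ * c"] if_distrib[of "\<lambda>c. c * _"] cong: if_cong)
    then have "ip r x (mv r (\<lambda>k l. \<kappa>' * (if k = l then 1 else 0)) x) = ip r x (\<lambda>k. \<kappa>' * x k)"
      by (intro ip_cong) auto
    moreover have "ip r x (mv r (\<lambda>k l. \<Sum>i\<in>R. u i k * u i l) x) = (\<Sum>i\<in>R. (ip r (u i) x)\<^sup>2)"
      using ip_rank_one[of r x 1] by (simp only: mv_linear(7) ip_sum_right) simp
    ultimately show ?thesis unfolding Q_def
      by (simp only: mv_linear(5) ip_diff_right) (simp add: ip_scale_right)
  qed
  have Yquad: "ip r x (mv r (Y i) x) = t * (c i * (ip r (u i) x)\<^sup>2 + 1 / real m * ip r x (mv r Q x))" for i x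
    unfolding Y_def by (simp only: mv_linear(4,6) ip_add_right ip_scale_right ip_rank_one)
      (simp add: ip_rank_one[symmetric] mv_linear ip_scale_right)
  have Qpos: "0 \<le> ip r x (mv r Q x)" for x
    using rest_le[of x] by (simp add: Qquad \<kappa>'_def R_def)
  have Yle: "ip r x (mv r (Y i) x) \<le> K * ip r x x" if "i \<in> set_pmf q" for i x
  proof -
    have i: "i \<in> {..<N} - D" using that set_q by auto
    have "c i * (ip r (u i) x)\<^sup>2 \<le> c i * (ip r (u i) (u i) * ip r x x)"
      by (intro mult_left_mono ip_cauchy_schwarz c_nonneg)
    also have "\<dots> \<le> \<kappa> / real m * ip r x x"
      using mult_right_mono[OF c_row_norm_le[OF i] ip_self_nonneg] by (simp add: mult.assoc)
    finally have 1: "c i * (ip r (u i) x)\<^sup>2 \<le> \<kappa> / real m * ip r x x" .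
    have "ip r x (mv r Q x) \<le> \<kappa>' * ip r x x"
      by (simp add: Qquad sum_nonneg)
    also have "\<dots> \<le> \<kappa> * ip r x x" by (intro mult_right_mono ip_self_nonneg) (simp add: \<kappa>'_def)
    finally have "1 / real m * ip r x (mv r Q x) \<le> \<kappa> / real m * ip r x x"
      using m by (simp add: divide_right_mono)
    with 1 have "ip r x (mv r (Y i) x) \<le> t * (2 * (\<kappa> / real m * ip r x x))"
      unfolding Yquad using t by (intro mult_left_mono) auto
    also have "\<dots> = K * ip r x x" using m kappa_pos by (simp add: t_def)
    finally show ?thesis .
  qed
  have sq: "ip r (mv r (Y i) x) (mv r (Y i) x) \<le> K * ip r x (mv r (Y i) x)" if "i \<in> set_pmf q" for i x
  proof (rule psd_square_le[OF Ysym K _ Yle[OF that]])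
    show "0 \<le> ip r x (mv r (Y i) x)" for x
      unfolding Yquad using t Qpos c_nonneg by (intro mult_nonneg_nonneg add_nonneg_nonneg) auto
  qed
  have mean: "measure_pmf.expectation q (\<lambda>i. Y i k l) = (if k = l then t * \<kappa>' / real m else 0)"
    if "k < r" "l < r" for k l
  proof -
    have "measure_pmf.expectation q (\<lambda>i. Y i k l)
        = (\<Sum>i\<in>R. t * (pmf q i * (c i * u i k) * u i l)) + (\<Sum>i\<in>R. pmf q i) * (t * (1 / real m * Q k l))"
      unfolding expectation_q R_def[symmetric] Y_def sum_distrib_right sum.distrib[symmetric]
      by (intro sum.cong) (simp_all add: algebra_simps)
    also have "(\<Sum>i\<in>R. pmf q i) = 1" using set_q by (simp add: R_def sum_pmf_eq_1)
    also have "(\<Sum>i\<in>R. t * (pmf q i * (c i * u i k) * u i l)) = (\<Sum>i\<in>R. t / real m * (u i k * u i l))"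
      using q_times_c that by (intro sum.cong) (auto simp: R_def)
    also have "\<dots> = t / real m * (\<Sum>i\<in>R. u i k * u i l)" by (simp add: sum_distrib_left)
    finally show ?thesis by (simp add: Q_def algebra_simps)
  qed
  \<comment> \<open>The \<open>m\<close> shares of \<open>Q\<close> add up to
    \<open>\<kappa>'\<close> minus the rows outside \<open>D\<close>, which is
    \<open>\<kappa>' - 1\<close> plus the rows in \<open>D\<close>. On the unit sphere the form of
    the summed \<open>Y\<close> is thus
    \<open>t * (sketch_quad \<xi> x - 1 + \<kappa>')\<close>.\<close>
  have sub: "{\<xi>. \<exists>x. ip r x x = 1 \<and> sketch_quad \<xi> x \<le> 1 / sqrt 2}
      \<subseteq> {\<xi>. \<exists>x. ip r x x = 1 \<and>
            ip r x (mv r (\<lambda>k l. \<Sum>j\<in>{..<m}. Y (\<xi> j) k l) x) \<le> t * (1 / sqrt 2 - 1 + \<kappa>')}"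
  proof safe
    fix \<xi> x assume x: "ip r x x = 1" and s: "sketch_quad \<xi> x \<le> 1 / sqrt 2"
    have "ip r x (mv r (\<lambda>k l. \<Sum>j\<in>{..<m}. Y (\<xi> j) k l) x)
        = (\<Sum>j<m. t * (c (\<xi> j) * (ip r (u (\<xi> j)) x)\<^sup>2 + 1 / real m * ip r x (mv r Q x)))"
      by (simp only: mv_linear(7) ip_sum_right Yquad)
    also have "\<dots> = t * ((\<Sum>j<m. c (\<xi> j) * (ip r (u (\<xi> j)) x)\<^sup>2) + ip r x (mv r Q x))"
      using m by (simp add: sum.distrib sum_distrib_left[symmetric])
    also have "(\<Sum>j<m. c (\<xi> j) * (ip r (u (\<xi> j)) x)\<^sup>2) + ip r x (mv r Q x) = sketch_quad \<xi> x - 1 + \<kappa>'"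
      using split_sum[of "\<lambda>i. (ip r (u i) x)\<^sup>2"] sum_rows_sq[of x] x
      by (simp add: Qquad sketch_quad_def R_def)
    also have "t * \<dots> \<le> t * (1 / sqrt 2 - 1 + \<kappa>')" using s t by (intro mult_left_mono) auto
    finally show "\<exists>x. ip r x x = 1 \<and>
        ip r x (mv r (\<lambda>k l. \<Sum>j\<in>{..<m}. Y (\<xi> j) k l) x) \<le> t * (1 / sqrt 2 - 1 + \<kappa>')"
      using x by blast
  qed
  have eK: "exp (- K) = 1 / sqrt 2"
  proof -
    have "K = ln (sqrt 2)" by (simp add: K_def ln_sqrt)
    then have "exp K = sqrt 2" by simp
    then show ?thesis by (simp add: exp_minus inverse_eq_divide)
  qed
  \<comment> \<open>This is \<open>1 - exp (- K) \<le> K\<close>. It makes the exponent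
    nondecreasing in \<open>\<kappa>'\<close>, so \<open>\<kappa>' = 1\<close> is the worst
    case.\<close>
  have eta: "1 - 1 / sqrt 2 \<le> K"
  proof -
    have "sqrt 2 \<le> (3 / 2 :: real)" by (rule real_le_lsqrt) (auto simp: power2_eq_square)
    then have "1 - 1 / sqrt 2 \<le> 1 / (3 :: real)" by (simp add: field_simps)
    then show ?thesis using ln2_ge_two_thirds by (simp add: K_def)
  qed
  have "measure_pmf.prob sample {\<xi>. \<exists>x. ip r x x = 1 \<and> sketch_quad \<xi> x \<le> 1 / sqrt 2}
      \<le> measure_pmf.prob sample {\<xi>. \<exists>x. ip r x x = 1 \<and>
            ip r x (mv r (\<lambda>k l. \<Sum>j\<in>{..<m}. Y (\<xi> j) k l) x) \<le> t * (1 / sqrt 2 - 1 + \<kappa>')}"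
    by (rule measure_pmf.finite_measure_mono[OF sub]) simp
  also have "\<dots> \<le> real r * exp (t * (1 / sqrt 2 - 1 + \<kappa>') - real (card {..<m}) * ((1 - exp (-K)) / K * (t * \<kappa>' / real m)))"
    by (rule matrix_chernoff_lower[OF _ finite_q Ysym K sq mean]) auto
  also have "t * (1 / sqrt 2 - 1 + \<kappa>') - real (card {..<m}) * ((1 - exp (-K)) / K * (t * \<kappa>' / real m))
      = real m / (2 * \<kappa>) * (K * (1 / sqrt 2 - 1) + (K - (1 - 1 / sqrt 2)) * \<kappa>')"
  proof -
    have "real (card {..<m}) * ((1 - exp (-K)) / K * (t * \<kappa>' / real m)) = (1 - 1 / sqrt 2) * (real m / (2 * \<kappa>)) * \<kappa>'"
      using m K by (simp add: eK t_def)
    moreover have "K * a * (b - 1 + \<kappa>') - (1 - b) * a * \<kappa>' = a * (K * (b - 1) + (K - (1 - b)) * \<kappa>')" for a b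
      by (simp add: algebra_simps)
    ultimately show ?thesis unfolding t_def by (simp only:)
  qed
  also have "\<dots> \<le> real m / (2 * \<kappa>) * (K * (1 / sqrt 2 - 1) + (K - (1 - 1 / sqrt 2)) * 1)"
    using eta kappa_pos by (intro mult_left_mono add_left_mono) (auto simp: \<kappa>'_def)
  also have "\<dots> = - (1 - 1 / sqrt 2 - ln 2 / (2 * sqrt 2)) * (real m / (2 * \<kappa>))"
  proof -
    have "a * (K * (b - 1) + (K - (1 - b)) * 1) = - (1 - b - K * b) * a" for a b
      by (simp add: algebra_simps)
    moreover have "K * (1 / sqrt 2) = ln 2 / (2 * sqrt 2)" by (simp add: K_def)
    ultimately show ?thesis by (simp only:)
  qed
  finally show ?thesis by (simp add: mult_left_mono)
qed

section \<open>The sketched cross term \<open>U\<^sup>T S\<^sup>T S W\<close>\<close>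

definition sketch_cross :: "(nat \<Rightarrow> nat) \<Rightarrow> (nat \<Rightarrow> nat \<Rightarrow> real) \<Rightarrow> nat \<Rightarrow> nat \<Rightarrow> real" where
  "sketch_cross \<xi> w k l = (\<Sum>i\<in>D. u i k * w i l) + (\<Sum>j<m. c (\<xi> j) * (u (\<xi> j) k * w (\<xi> j) l))"

text \<open>Since \<open>U\<^sup>T W = 0\<close>, the part of an entry coming from \<open>D\<close>
  is minus the mean of its sampled part, so only a variance remains. In the second moment one factor
  \<open>c i\<close> cancels against \<open>m * pmf q i\<close>; the other, together with the
  squared row norm, is at most \<open>\<kappa> / m\<close>.\<close>

lemma expectation_sketch_cross_le:
  assumes w: "\<And>k l. k < r \<Longrightarrow> l < n \<Longrightarrow> (\<Sum>i<N. u i k * w i l) = 0"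
  shows "measure_pmf.expectation sample (\<lambda>\<xi>. \<Sum>k<r. \<Sum>l<n. (sketch_cross \<xi> w k l)\<^sup>2)
    \<le> \<kappa> / real m * (\<Sum>i<N. \<Sum>l<n. (w i l)\<^sup>2)"
proof -
  let ?R = "{..<N} - D"
  have "finite (set_pmf sample)" using finite_q by (intro finite_set_Pi_pmf) auto
  note [simp] = integrable_measure_pmf_finite[OF this]
  have entry: "measure_pmf.expectation sample (\<lambda>\<xi>. (sketch_cross \<xi> w k l)\<^sup>2)
      \<le> (\<Sum>i\<in>?R. c i * (u i k * w i l)\<^sup>2)" if kl: "k < r" "l < n" for k l
  proof -
    have qc: "pmf q i * (c i * (u i k * y)) = u i k * y / real m" if "i \<in> ?R" for i y
      using arg_cong[OF q_times_c[OF that kl(1)], of "\<lambda>x. x * y"] by (simp add: mult_ac)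
    have "measure_pmf.expectation q (\<lambda>i. c i * (u i k * w i l)) = (\<Sum>i\<in>?R. u i k * w i l / real m)"
      unfolding expectation_q using qc by (intro sum.cong) auto
    then have g: "(\<Sum>i\<in>D. u i k * w i l)
        = - real (card {..<m}) * measure_pmf.expectation q (\<lambda>i. c i * (u i k * w i l))"
      using w[OF kl] split_sum[of "\<lambda>i. u i k * w i l"] m by (simp add: sum_divide_distrib[symmetric])
    have "measure_pmf.expectation sample (\<lambda>\<xi>. (sketch_cross \<xi> w k l)\<^sup>2)
        \<le> real (card {..<m}) * measure_pmf.expectation q (\<lambda>i. (c i * (u i k * w i l))\<^sup>2)"
      unfolding sketch_cross_def by (rule expectation_Pi_pmf_sum_sq_centered_le[OF _ finite_q g]) simp
    also have "\<dots> = (\<Sum>i\<in>?R. real m * (pmf q i * (c i * (u i k * (c i * u i k * (w i l)\<^sup>2)))))"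
      by (simp add: expectation_q sum_distrib_left power2_eq_square mult_ac)
    also have "\<dots> = (\<Sum>i\<in>?R. c i * (u i k * w i l)\<^sup>2)"
    proof (intro sum.cong refl)
      fix i assume "i \<in> ?R"
      then show "real m * (pmf q i * (c i * (u i k * (c i * u i k * (w i l)\<^sup>2)))) = c i * (u i k * w i l)\<^sup>2"
        using m by (subst qc) (simp_all add: power2_eq_square mult_ac)
    qed
    finally show ?thesis .
  qed
  have "measure_pmf.expectation sample (\<lambda>\<xi>. \<Sum>k<r. \<Sum>l<n. (sketch_cross \<xi> w k l)\<^sup>2)
      = (\<Sum>k<r. \<Sum>l<n. measure_pmf.expectation sample (\<lambda>\<xi>. (sketch_cross \<xi> w k l)\<^sup>2))"
    by simp
  also have "\<dots> \<le> (\<Sum>k<r. \<Sum>l<n. \<Sum>i\<in>?R. c i * (u i k * w i l)\<^sup>2)"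
    using entry by (intro sum_mono) auto
  also have "\<dots> = (\<Sum>k<r. \<Sum>i\<in>?R. \<Sum>l<n. c i * (u i k * w i l)\<^sup>2)"
    by (intro sum.cong refl sum.swap)
  also have "\<dots> = (\<Sum>i\<in>?R. \<Sum>k<r. \<Sum>l<n. c i * (u i k * w i l)\<^sup>2)" by (rule sum.swap)
  also have "\<dots> = (\<Sum>i\<in>?R. c i * ip r (u i) (u i) * (\<Sum>l<n. (w i l)\<^sup>2))"
    by (simp add: ip_def power2_eq_square sum_product sum_distrib_left sum_distrib_right mult_ac)
  also have "\<dots> \<le> (\<Sum>i\<in>?R. \<kappa> / real m * (\<Sum>l<n. (w i l)\<^sup>2))"
    using c_row_norm_le by (intro sum_mono mult_right_mono sum_nonneg) auto
  also have "\<dots> \<le> (\<Sum>i<N. \<kappa> / real m * (\<Sum>l<n. (w i l)\<^sup>2))"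
    using kappa_pos by (intro sum_mono2) (auto intro!: divide_nonneg_nonneg mult_nonneg_nonneg sum_nonneg)
  also have "\<dots> = \<kappa> / real m * (\<Sum>i<N. \<Sum>l<n. (w i l)\<^sup>2)" by (simp add: sum_distrib_left)
  finally show ?thesis .
qed

text \<open>A union bound with \<open>\<delta> / 2\<close> for each of the two failures. The first
  entry of the maximum serves the Chernoff bound, the second makes \<open>\<kappa> / m\<close> at
  most \<open>\<delta> * \<epsilon> / 4\<close> for Markov's inequality.\<close>

lemma sample_good:
  assumes \<epsilon>: "0 < \<epsilon>" and \<delta>: "0 < \<delta>" and C: "C = sqrt 2 / (sqrt 2 - 1 - ln 2 / 2)"
    and m_ge: "\<kappa> * max (2 * C * ln (2 * real r / \<delta>)) (4 / (\<delta> * \<epsilon>)) \<le> real m"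
    and w: "\<And>k l. k < r \<Longrightarrow> l < n \<Longrightarrow> (\<Sum>i<N. u i k * w i l) = 0"
  shows "measure_pmf.prob sample
      {\<xi>. (\<forall>x. ip r x x / sqrt 2 \<le> sketch_quad \<xi> x) \<and>
           (\<Sum>k<r. \<Sum>l<n. (sketch_cross \<xi> w k l)\<^sup>2) \<le> \<epsilon> / 2 * (\<Sum>i<N. \<Sum>l<n. (w i l)\<^sup>2)}
      \<ge> 1 - \<delta>" (is "measure_pmf.prob _ ?G \<ge> _")
proof -
  let ?W = "\<Sum>i<N. \<Sum>l<n. (w i l)\<^sup>2"
  let ?B1 = "{\<xi>. \<exists>x. ip r x x = 1 \<and> sketch_quad \<xi> x \<le> 1 / sqrt 2}"
  let ?B2 = "{\<xi>. (\<Sum>k<r. \<Sum>l<n. (sketch_cross \<xi> w k l)\<^sup>2) > \<epsilon> / 2 * ?W}"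
  have W: "?W \<ge> 0" by (intro sum_nonneg) auto
  have "1.4 \<le> sqrt (2::real)" by (rule real_le_rsqrt) (auto simp: power2_eq_square)
  then have C0: "sqrt 2 - 1 - ln 2 / 2 > (0::real)" using ln2_le_25_over_36 by simp
  then have Cpos: "C > 0" by (simp add: C)
  have invC: "1 - 1 / sqrt 2 - ln 2 / (2 * sqrt 2) = 1 / C"
    by (simp add: C field_simps)
  have "measure_pmf.prob sample ?B1 \<le> real r * exp (- (1 / C) * (real m / (2 * \<kappa>)))"
    using prob_sketch_quad_le unfolding invC .
  also have "\<dots> \<le> real r * exp (- ln (2 * real r / \<delta>))"
  proof -
    have "\<kappa> * (2 * C * ln (2 * real r / \<delta>)) \<le> real m"
      using m_ge kappa_pos by (meson max.cobounded1 mult_left_mono order_trans less_imp_le)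
    then have "ln (2 * real r / \<delta>) \<le> (1 / C) * (real m / (2 * \<kappa>))"
      using Cpos kappa_pos by (simp add: field_simps)
    then show ?thesis by (intro mult_left_mono) auto
  qed
  also have "\<dots> = \<delta> / 2" using r \<delta> by (simp add: exp_minus)
  finally have B1: "measure_pmf.prob sample ?B1 \<le> \<delta> / 2" .
  have B2: "measure_pmf.prob sample ?B2 \<le> \<delta> / 2"
  proof (rule prob_gt_le)
    show "finite (set_pmf sample)" using finite_q by (intro finite_set_Pi_pmf) auto
    have "\<kappa> * (4 / (\<delta> * \<epsilon>)) \<le> real m"
      using m_ge kappa_pos by (meson max.cobounded2 mult_left_mono order_trans less_imp_le)
    then have "\<kappa> / real m \<le> \<delta> / 2 * (\<epsilon> / 2)" using m \<epsilon> \<delta> by (simp add: field_simps)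
    then have "\<kappa> / real m * ?W \<le> \<delta> / 2 * (\<epsilon> / 2) * ?W" using W by (rule mult_right_mono)
    with expectation_sketch_cross_le[OF w]
    have "measure_pmf.expectation sample (\<lambda>\<xi>. \<Sum>k<r. \<Sum>l<n. (sketch_cross \<xi> w k l)\<^sup>2)
        \<le> \<delta> / 2 * (\<epsilon> / 2) * ?W" by (rule order_trans)
    then show "measure_pmf.expectation sample (\<lambda>\<xi>. \<Sum>k<r. \<Sum>l<n. (sketch_cross \<xi> w k l)\<^sup>2)
        \<le> \<delta> / 2 * (\<epsilon> / 2 * ?W)" by (simp only: mult.assoc)
  qed (use \<epsilon> \<delta> W in \<open>auto intro!: sum_nonneg\<close>)
  have sub: "UNIV - ?G \<subseteq> ?B1 \<union> ?B2"
  proof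
    fix \<xi> assume \<xi>: "\<xi> \<in> UNIV - ?G"
    show "\<xi> \<in> ?B1 \<union> ?B2"
    proof (cases "\<xi> \<in> ?B2")
      case False
      then obtain x where x: "sketch_quad \<xi> x < ip r x x / sqrt 2" using \<xi> by (auto simp: not_le)
      \<comment> \<open>Nonnegativity excludes \<open>x = 0\<close>, and by homogeneity the
        violation persists on the unit sphere.\<close>
      have "0 \<le> sketch_quad \<xi> x"
        unfolding sketch_quad_def by (intro add_nonneg_nonneg sum_nonneg mult_nonneg_nonneg c_nonneg) auto
      then have "0 < ip r x x / sqrt 2" using x by linarith
      then have pos: "0 < ip r x x" by (simp add: zero_less_divide_iff)
      define s where "s = 1 / sqrt (ip r x x)"
      have s: "s * s = 1 / ip r x x" using pos by (simp add: s_def)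
      have "ip r (\<lambda>k. s * x k) (\<lambda>k. s * x k) = 1"
        using s pos by (simp add: ip_scale_left ip_scale_right mult.assoc[symmetric])
      moreover have "sketch_quad \<xi> (\<lambda>k. s * x k) = s * s * sketch_quad \<xi> x"
        by (simp add: sketch_quad_def ip_scale_right power_mult_distrib sum_distrib_left
            distrib_left power2_eq_square mult_ac)
      moreover have "s * s * sketch_quad \<xi> x \<le> 1 / sqrt 2"
      proof -
        have "sketch_quad \<xi> x \<le> 1 / sqrt 2 * ip r x x" using x by simp
        then show ?thesis unfolding s using pos by (simp add: divide_le_eq mult.commute)
      qed
      ultimately have "ip r (\<lambda>k. s * x k) (\<lambda>k. s * x k) = 1 \<and> sketch_quad \<xi> (\<lambda>k. s * x k) \<le> 1 / sqrt 2"
        by simp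
      then show ?thesis by blast
    qed simp
  qed
  have "1 - measure_pmf.prob sample ?G = measure_pmf.prob sample (UNIV - ?G)"
    using measure_pmf.prob_compl[of ?G sample] by simp
  also have "\<dots> \<le> measure_pmf.prob sample (?B1 \<union> ?B2)"
    by (rule measure_pmf.finite_measure_mono[OF sub]) simp
  also have "\<dots> \<le> measure_pmf.prob sample ?B1 + measure_pmf.prob sample ?B2"
    by (rule measure_Un_le) auto
  also have "\<dots> \<le> \<delta>" using B1 B2 by simp
  finally show ?thesis by simp
qed

end

subsection \<open>Least squares and the sketching matrix\<close>

lemma frobenius_norm_sq:
  "(frobenius_norm A)\<^sup>2 = (\<Sum>i<dim_row A. \<Sum>j<dim_col A. (A $$ (i, j))\<^sup>2)"
  by (simp add: frobenius_norm_def sum_nonneg)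

lemma mult_mat_index:
  assumes "A \<in> carrier_mat a b" "Y \<in> carrier_mat b n" "i < a" "j < n"
  shows "(A * Y) $$ (i, j) = (\<Sum>k<b. A $$ (i, k) * Y $$ (k, j))"
  using assms by (auto simp: scalar_prod_def atLeast0LessThan intro!: sum.cong)

text \<open>First variation: moving the minimizer by \<open>t\<close> times \<open>Y\<close> changes
  the objective by a quadratic polynomial in \<open>t\<close> that is nonnegative and has no
  constant term, so its linear coefficient vanishes.\<close>

lemma normal_equations:
  assumes A: "A \<in> carrier_mat a b" and B: "B \<in> carrier_mat a n"
    and X: "least_squares_minimizer A B X" and Y: "Y \<in> carrier_mat b n"
  shows "(\<Sum>i<a. \<Sum>j<n. (A * Y) $$ (i, j) * ((A * X) $$ (i, j) - B $$ (i, j))) = 0"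
proof -
  have Xc: "X \<in> carrier_mat b n"
    and min: "\<And>Z. Z \<in> carrier_mat b n \<Longrightarrow> (frobenius_norm (A * X - B))\<^sup>2 \<le> (frobenius_norm (A * Z - B))\<^sup>2"
    using X A B by (auto simp: least_squares_minimizer_def is_arg_min_def not_less)
  define P where "P = (\<Sum>i<a. \<Sum>j<n. (A * Y) $$ (i, j) * ((A * X) $$ (i, j) - B $$ (i, j)))"
  define Q where "Q = (\<Sum>i<a. \<Sum>j<n. ((A * Y) $$ (i, j))\<^sup>2)"
  have Q: "Q \<ge> 0" unfolding Q_def by (intro sum_nonneg) auto
  have f: "(frobenius_norm (A * Z - B))\<^sup>2 = (\<Sum>i<a. \<Sum>j<n. ((A * Z) $$ (i, j) - B $$ (i, j))\<^sup>2)"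
    if "Z \<in> carrier_mat b n" for Z
    using A B that by (simp add: frobenius_norm_sq)
  have "0 \<le> 2 * t * P + t\<^sup>2 * Q" for t
  proof -
    have Z: "X + t \<cdot>\<^sub>m Y \<in> carrier_mat b n" using Xc Y by simp
    have "(A * (X + t \<cdot>\<^sub>m Y)) $$ (i, j) = (A * X) $$ (i, j) + t * (A * Y) $$ (i, j)" if "i < a" "j < n" for i j
    proof -
      have "(A * (X + t \<cdot>\<^sub>m Y)) $$ (i, j) = (\<Sum>k<b. A $$ (i, k) * (X $$ (k, j) + t * Y $$ (k, j)))"
        using that Xc Y by (simp add: mult_mat_index[OF A Z])
      then show ?thesis
        by (simp add: mult_mat_index[OF A Xc that] mult_mat_index[OF A Y that] sum_distrib_left
            sum.distrib distrib_left mult.left_commute)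
    qed
    then have "(frobenius_norm (A * (X + t \<cdot>\<^sub>m Y) - B))\<^sup>2
        = (\<Sum>i<a. \<Sum>j<n. ((A * X) $$ (i, j) - B $$ (i, j))\<^sup>2 + 2 * t * ((A * Y) $$ (i, j) * ((A * X) $$ (i, j) - B $$ (i, j)))
            + t\<^sup>2 * ((A * Y) $$ (i, j))\<^sup>2)"
      unfolding f[OF Z] by (intro sum.cong refl) (simp add: power2_eq_square algebra_simps)
    also have "\<dots> = (frobenius_norm (A * X - B))\<^sup>2 + 2 * t * P + t\<^sup>2 * Q"
      unfolding f[OF Xc] P_def Q_def sum_distrib_left sum.distrib by simp
    finally show ?thesis using min[OF Z] by simp
  qed
  \<comment> \<open>At \<open>-t\<close> the polynomial equals
    \<open>- (t\<^sup>2 * (Q + 2))\<close>; the summand 1 in the denominator covers the case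
    \<open>Q = 0\<close>.\<close>
  moreover define t where "t = P / (Q + 1)"
  moreover have P: "P = t * (Q + 1)" using Q by (simp add: t_def)
  ultimately have "0 \<le> 2 * (- t) * (t * (Q + 1)) + (- t)\<^sup>2 * Q" by metis
  then have "t\<^sup>2 * (Q + 2) \<le> 0" by (simp add: power2_eq_square algebra_simps)
  then have "t = 0" using Q by (simp add: mult_le_0_iff)
  then have "P = 0" using P by simp
  then show ?thesis by (simp add: P_def)
qed

text \<open>It holds for every outcome: a draw outside \<open>{..<N}\<close> or in \<open>ks\<close>
  has residual probability 0, and then its row of \<open>S\<close> and its weight
  \<open>1 / (real m * 0)\<close> both vanish.\<close>

lemma hybrid_matrix_form:
  assumes p: "p \<in> carrier_vec N" and ks: "distinct ks" "set ks \<subseteq> {..<N}"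
    and nonneg: "\<And>i. 0 \<le> residual_prob p ks i"
    and Z: "Z \<in> carrier_mat N n" and Z': "Z' \<in> carrier_mat N n"
    and l: "l < n"
    and S_def: "S = hybrid_matrix (length ks + m) p ks \<xi>"
  shows "(\<Sum>i<length ks + m. (S * Z) $$ (i, l) * (S * Z') $$ (i, l))
      = (\<Sum>i\<in>set ks. Z $$ (i, l) * Z' $$ (i, l))
        + (\<Sum>j<m. 1 / (real m * residual_prob p ks (\<xi> j)) * (Z $$ (\<xi> j, l) * Z' $$ (\<xi> j, l)))"
proof -
  let ?d = "length ks" and ?q = "residual_prob p ks"
  have S: "S \<in> carrier_mat (?d + m) N"
    using p by (auto simp: S_def hybrid_matrix_def append_rows_def)
  have S1: "S $$ (i, k) = (if k = ks ! i then 1 else 0)" if "i < ?d" "k < N" for i k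
    using p that by (simp add: S_def hybrid_matrix_def append_rows_def)
  have S2: "S $$ (?d + j, k) = (if \<xi> j = k then 1 / sqrt (real m * ?q k) else 0)" if "j < m" "k < N" for j k
    using p that by (simp add: S_def hybrid_matrix_def append_rows_def)
  have top: "(S * X) $$ (i, l) = X $$ (ks ! i, l)" if "X \<in> carrier_mat N n" "i < ?d" for X i
  proof -
    have "ks ! i < N" using ks(2) that(2) nth_mem by blast
    then show ?thesis using that l
      by (simp add: mult_mat_index[OF S that(1)] S1 if_distrib[of "\<lambda>c. c * _"] cong: if_cong)
  qed
  have bot: "(S * X) $$ (?d + j, l) = (if \<xi> j < N then 1 / sqrt (real m * ?q (\<xi> j)) * X $$ (\<xi> j, l) else 0)"
    if "X \<in> carrier_mat N n" "j < m" for X j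
  proof -
    have "(S * X) $$ (?d + j, l) = (\<Sum>k<N. S $$ (?d + j, k) * X $$ (k, l))"
      using that l by (intro mult_mat_index[OF S]) auto
    also have "\<dots> = (\<Sum>k<N. if \<xi> j = k then 1 / sqrt (real m * ?q k) * X $$ (k, l) else 0)"
      using that by (intro sum.cong) (auto simp: S2)
    also have "\<dots> = (if \<xi> j < N then 1 / sqrt (real m * ?q (\<xi> j)) * X $$ (\<xi> j, l) else 0)"
      by (subst sum.delta') auto
    finally show ?thesis .
  qed
  have "(\<Sum>i<?d + m. (S * Z) $$ (i, l) * (S * Z') $$ (i, l))
      = (\<Sum>i<?d. (S * Z) $$ (i, l) * (S * Z') $$ (i, l))
        + (\<Sum>j<m. (S * Z) $$ (?d + j, l) * (S * Z') $$ (?d + j, l))"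
    by (induction m) (simp_all add: add.assoc)
  also have "(\<Sum>i<?d. (S * Z) $$ (i, l) * (S * Z') $$ (i, l)) = (\<Sum>i<?d. Z $$ (ks ! i, l) * Z' $$ (ks ! i, l))"
    using Z Z' by (intro sum.cong) (auto simp: top)
  also have "\<dots> = (\<Sum>i\<in>set ks. Z $$ (i, l) * Z' $$ (i, l))"
    using ks(1) by (intro sum.reindex_bij_betw[of _ _ _ "\<lambda>i. Z $$ (i, l) * Z' $$ (i, l)"] bij_betw_nth) auto
  also have "(\<Sum>j<m. (S * Z) $$ (?d + j, l) * (S * Z') $$ (?d + j, l))
      = (\<Sum>j<m. 1 / (real m * ?q (\<xi> j)) * (Z $$ (\<xi> j, l) * Z' $$ (\<xi> j, l)))"
  proof (intro sum.cong refl)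
    fix j assume j: "j \<in> {..<m}"
    have "1 / sqrt (real m * ?q (\<xi> j)) * x * (1 / sqrt (real m * ?q (\<xi> j)) * y) = 1 / (real m * ?q (\<xi> j)) * (x * y)" for x y
      using nonneg by simp
    moreover have "?q (\<xi> j) = 0" if "\<not> \<xi> j < N" using that p by (simp add: residual_prob_def)
    ultimately show "(S * Z) $$ (?d + j, l) * (S * Z') $$ (?d + j, l)
        = 1 / (real m * ?q (\<xi> j)) * (Z $$ (\<xi> j, l) * Z' $$ (\<xi> j, l))"
      using j Z Z' by (cases "\<xi> j < N") (simp_all only: bot lessThan_iff if_True if_False, simp_all)
  qed
  finally show ?thesis .
qed

text \<open>\<open>z\<close> stands for the difference of two fits in the coordinates of the
  orthonormal columns, and \<open>normal\<close> is the sketched normal equation tested with that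
  difference itself. It equates the sketched energy of \<open>z\<close> with minus its pairing with
  \<open>sketch_cross\<close>; the lower bound \<open>quad\<close> turns this into a bound on
  \<open>z\<close>.\<close>

lemma (in leverage_sampling) sketch_solution_le:
  fixes n :: nat and z w :: "nat \<Rightarrow> nat \<Rightarrow> real"
  assumes quad: "\<And>x. ip r x x / sqrt 2 \<le> sketch_quad \<xi> x"
  defines "e \<equiv> \<lambda>i l. ip r (u i) (\<lambda>k. z k l)"
  assumes normal: "(\<Sum>l<n. (\<Sum>i\<in>D. e i l * (e i l + w i l))
      + (\<Sum>j<m. c (\<xi> j) * (e (\<xi> j) l * (e (\<xi> j) l + w (\<xi> j) l)))) = 0"
  shows "(\<Sum>k<r. \<Sum>l<n. (z k l)\<^sup>2) \<le> 2 * (\<Sum>k<r. \<Sum>l<n. (sketch_cross \<xi> w k l)\<^sup>2)"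
proof -
  let ?g = "sketch_cross \<xi> w"
  have cross: "(\<Sum>i\<in>D. e i l * w i l) + (\<Sum>j<m. c (\<xi> j) * (e (\<xi> j) l * w (\<xi> j) l)) = (\<Sum>k<r. z k l * ?g k l)" for l
  proof -
    have "(\<Sum>i\<in>D. e i l * w i l) = (\<Sum>k<r. z k l * (\<Sum>i\<in>D. u i k * w i l))"
      unfolding e_def ip_def sum_distrib_left sum_distrib_right
      by (subst sum.swap) (simp add: mult_ac)
    moreover have "(\<Sum>j<m. c (\<xi> j) * (e (\<xi> j) l * w (\<xi> j) l))
        = (\<Sum>k<r. z k l * (\<Sum>j<m. c (\<xi> j) * (u (\<xi> j) k * w (\<xi> j) l)))"
      unfolding e_def ip_def sum_distrib_left sum_distrib_right
      by (subst sum.swap) (simp add: mult_ac)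
    ultimately show ?thesis by (simp add: sketch_cross_def sum.distrib distrib_left)
  qed
  have "(\<Sum>l<n. sketch_quad \<xi> (\<lambda>k. z k l) + (\<Sum>k<r. z k l * ?g k l)) = 0"
  proof -
    have "(\<Sum>i\<in>D. e i l * (e i l + w i l)) + (\<Sum>j<m. c (\<xi> j) * (e (\<xi> j) l * (e (\<xi> j) l + w (\<xi> j) l)))
        = sketch_quad \<xi> (\<lambda>k. z k l) + (\<Sum>k<r. z k l * ?g k l)" for l
      unfolding cross[symmetric] sketch_quad_def e_def
      by (simp add: distrib_left sum.distrib power2_eq_square)
    then show ?thesis using normal by simp
  qed
  moreover have "ip r (\<lambda>k. z k l) (\<lambda>k. z k l) / sqrt 2 \<le> sketch_quad \<xi> (\<lambda>k. z k l)" for l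
    by (rule quad)
  ultimately have "(\<Sum>l<n. ip r (\<lambda>k. z k l) (\<lambda>k. z k l) / sqrt 2 + (\<Sum>k<r. z k l * ?g k l)) \<le> 0"
    by (metis (no_types, lifting) add_le_cancel_right sum_mono)
  also have "(\<Sum>l<n. ip r (\<lambda>k. z k l) (\<lambda>k. z k l) / sqrt 2 + (\<Sum>k<r. z k l * ?g k l))
      = (\<Sum>l<n. \<Sum>k<r. (z k l)\<^sup>2 / sqrt 2 + z k l * ?g k l)"
    by (simp add: ip_def sum.distrib sum_divide_distrib power2_eq_square)
  finally have le0: "(\<Sum>l<n. \<Sum>k<r. (z k l)\<^sup>2 / sqrt 2 + z k l * ?g k l) \<le> 0" .
  \<comment> \<open>Entrywise completion of the square, with
    \<open>(z k l + sqrt 2 * ?g k l)\<^sup>2\<close>, in place of Cauchy-Schwarz for the double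
    sum.\<close>
  have "(1 / (2 * sqrt 2)) * ((z k l)\<^sup>2 - 2 * (?g k l)\<^sup>2) \<le> (z k l)\<^sup>2 / sqrt 2 + z k l * ?g k l" for k l
  proof -
    have "0 \<le> (1 / (2 * sqrt 2)) * (z k l + sqrt 2 * ?g k l)\<^sup>2" by simp
    also have "\<dots> = (z k l)\<^sup>2 / (2 * sqrt 2) + z k l * ?g k l + (?g k l)\<^sup>2 / sqrt 2"
      by (simp add: power2_sum power_mult_distrib field_simps)
    finally have "0 \<le> (z k l)\<^sup>2 / (2 * sqrt 2) + z k l * ?g k l + (?g k l)\<^sup>2 / sqrt 2" .
    moreover have "(1 / (2 * sqrt 2)) * ((z k l)\<^sup>2 - 2 * (?g k l)\<^sup>2) = (z k l)\<^sup>2 / (2 * sqrt 2) - (?g k l)\<^sup>2 / sqrt 2"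
      by (simp add: right_diff_distrib diff_divide_distrib)
    moreover have "(z k l)\<^sup>2 / sqrt 2 = (z k l)\<^sup>2 / (2 * sqrt 2) + (z k l)\<^sup>2 / (2 * sqrt 2)"
      by simp
    ultimately show ?thesis by linarith
  qed
  then have "(\<Sum>l<n. \<Sum>k<r. (1 / (2 * sqrt 2)) * ((z k l)\<^sup>2 - 2 * (?g k l)\<^sup>2))
      \<le> (\<Sum>l<n. \<Sum>k<r. (z k l)\<^sup>2 / sqrt 2 + z k l * ?g k l)"
    by (intro sum_mono)
  from order_trans[OF this le0]
  have "(1 / (2 * sqrt 2)) * (\<Sum>l<n. \<Sum>k<r. (z k l)\<^sup>2 - 2 * (?g k l)\<^sup>2) \<le> 0"
    by (simp only: sum_distrib_left)
  then have "(\<Sum>l<n. \<Sum>k<r. (z k l)\<^sup>2 - 2 * (?g k l)\<^sup>2) \<le> 0"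
    by (simp add: divide_le_0_iff)
  then have "(\<Sum>k<r. \<Sum>l<n. (z k l)\<^sup>2 - 2 * (?g k l)\<^sup>2) \<le> 0" by (subst sum.swap)
  then show ?thesis by (simp add: sum_subtractf sum_distrib_left)
qed

section \<open>The guarantee for the sketched least squares problem\<close>

theorem theorem4p8:
  fixes N r n s s' :: nat
    and A B Xopt :: "real mat"
    and p :: "real Matrix.vec"
    and ks :: "nat list"
    and \<beta> \<epsilon> \<delta> C :: real
  assumes "1 \<le> r" and "r < N" and "1 \<le> n"
    and "A \<in> carrier_mat N r" and "vec_space.rank N A = r"
    and "B \<in> carrier_mat N n"
    and "p \<in> carrier_vec N" and "prob_vec p"
    and "0 < \<beta>" and "\<beta> \<le> 1"
    and "\<forall>i<N. \<beta> * leverage_score A i / real r \<le> p $ i"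
    and "distinct ks" and "set ks \<subseteq> {..<N}"
    and "p_det p ks < 1"
    and "0 < \<epsilon>" and "\<epsilon> < 1" and "0 < \<delta>" and "\<delta> < 1"
    and "C = sqrt 2 / (sqrt 2 - 1 - ln 2 / 2)"
    and "s' = nat \<lceil>(1 - p_det p ks) * (real r / \<beta>) *
                    max (2 * C * ln (2 * real r / \<delta>)) (4 / (\<delta> * \<epsilon>))\<rceil>"
    and "s = length ks + s'"
    and "least_squares_minimizer A B Xopt"
  shows "measure_pmf.prob (hybrid_sample s p ks)
           {S. \<forall>X. least_squares_minimizer (S * A) (S * B) X \<longrightarrow>
                 (frobenius_norm (A * X - B))\<^sup>2
                   \<le> (1 + \<epsilon>) * (frobenius_norm (A * Xopt - B))\<^sup>2}
         \<ge> 1 - \<delta>"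
proof -
  note A = assms(4) and B = assms(6) and p = assms(7) and ks = assms(12,13)
  let ?q = "residual_pmf p ks"
  have pd: "p_det p ks < 1" by fact
  have pmf_q: "pmf ?q i = residual_prob p ks i" for i
    using pmf_residual_pmf[OF assms(8) _ pd] ks p by auto
  have q0: "0 \<le> residual_prob p ks i" for i using pmf_nonneg[of ?q i] by (simp add: pmf_q)

  obtain U where ob: "orthonormal_basis_mat A U"
    using orthonormal_basis_mat_exists[OF A assms(5)] by blast
  have U: "U \<in> carrier_mat N r" using ob A by (auto simp: orthonormal_basis_mat_def)
  \<comment> \<open>\<open>R\<close> expresses changes of the solution in the orthonormal columns;
    conversely, \<open>T\<close> lets the normal equations of \<open>A\<close> be tested with the
    columns of \<open>U\<close>.\<close>
  obtain R where R: "R \<in> carrier_mat r r" "A = U * R"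
    using col_space_mat_mult[OF A U] ob A by (auto simp: orthonormal_basis_mat_def)
  obtain T where T: "T \<in> carrier_mat r r" "U = A * T"
    using col_space_mat_mult[OF U A] ob A by (auto simp: orthonormal_basis_mat_def)
  define u where "u i k = U $$ (i, k)" for i k
  have orth: "(\<Sum>i<N. u i k * u i l) = (if k = l then 1 else 0)" if "k < r" "l < r" for k l
  proof -
    have "col U k \<bullet> col U l = (if k = l then 1 else 0)"
      using ob that U by (auto simp: orthonormal_basis_mat_def)
    then show ?thesis using U that by (simp add: scalar_prod_def u_def atLeast0LessThan)
  qed

  have "\<beta> * ip r (u i) (u i) / real r \<le> p $ i" if "i < N" for i
  proof -
    have "leverage_score A i = ip r (u i) (u i)"
      using that leverage_score_eq[OF ob, of i] A U by (simp add: ip_def u_def power2_eq_square)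
    then show ?thesis using assms(11) that by metis
  qed
  moreover have s'_ge: "(1 - p_det p ks) * (real r / \<beta>) *
      max (2 * C * ln (2 * real r / \<delta>)) (4 / (\<delta> * \<epsilon>)) \<le> real s'"
    unfolding assms(20) by linarith
  moreover have "s' > 0"
  proof -
    have "0 < (1 - p_det p ks) * (real r / \<beta>) * (4 / (\<delta> * \<epsilon>))"
      using pd assms(1,9,15,17) by simp
    also have "\<dots> \<le> (1 - p_det p ks) * (real r / \<beta>) * max (2 * C * ln (2 * real r / \<delta>)) (4 / (\<delta> * \<epsilon>))"
      using pd assms(9) by (intro mult_left_mono) auto
    finally show ?thesis using s'_ge by linarith
  qed
  ultimately interpret leverage_sampling N r s' u "\<lambda>i. p $ i" "set ks" \<beta> "p_det p ks" ?q
    using assms(1,8,9) p ks pd orth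
    by unfold_locales (auto simp: prob_vec_def p_det_def pmf_q residual_prob_def)

  have Xopt: "Xopt \<in> carrier_mat r n"
    using assms(22) A B by (auto simp: least_squares_minimizer_def is_arg_min_def)
  define W where "W = A * Xopt - B"
  have W: "W \<in> carrier_mat N n" unfolding W_def by (intro minus_carrier_mat B)
  define w where "w i l = W $$ (i, l)" for i l
  have w_index: "w i l = (A * Xopt) $$ (i, l) - B $$ (i, l)" if "i < N" "l < n" for i l
    using that A Xopt B by (simp add: w_def W_def)
  have optimal: "(\<Sum>i<N. \<Sum>l<n. (A * Y) $$ (i, l) * w i l) = 0" if "Y \<in> carrier_mat r n" for Y
    using normal_equations[OF A B assms(22) that] by (simp add: w_index)
  have w_orth: "(\<Sum>i<N. u i k * w i l) = 0" if kl: "k < r" "l < n" for k l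
  proof -
    \<comment> \<open>\<open>U * E\<close> carries column \<open>k\<close> of \<open>U\<close> in
      column \<open>l\<close> and zeros elsewhere, so testing optimality with \<open>T * E\<close>
      isolates one entry of \<open>U\<^sup>T W\<close>.\<close>
    define E where "E = Matrix.mat r n (\<lambda>(k', l'). if k' = k \<and> l' = l then 1 else 0 :: real)"
    have E: "E \<in> carrier_mat r n" by (simp add: E_def)
    have "(U * E) $$ (i, l') = (if l' = l then u i k else 0)" if "i < N" "l' < n" for i l'
    proof -
      have "(U * E) $$ (i, l') = (\<Sum>k'<r. U $$ (i, k') * (if k' = k \<and> l' = l then 1 else 0))"
        unfolding mult_mat_index[OF U E that] using that by (simp add: E_def)
      also have "\<dots> = (\<Sum>k'<r. if k' = k then U $$ (i, k') * (if l' = l then 1 else 0) else 0)"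
        by (intro sum.cong) auto
      finally show ?thesis using kl by (simp add: u_def)
    qed
    moreover have "U * E = A * (T * E)" unfolding T(2) by (rule assoc_mult_mat[OF A T(1) E])
    ultimately have "(\<Sum>i<N. \<Sum>l'<n. (A * (T * E)) $$ (i, l') * w i l')
        = (\<Sum>i<N. \<Sum>l'<n. if l' = l then u i k * w i l' else 0)"
      by (intro sum.cong) auto
    then show ?thesis using optimal[of "T * E"] T E kl by simp
  qed
  have f: "(frobenius_norm (A * X - B))\<^sup>2 = (\<Sum>i<N. \<Sum>l<n. ((A * X) $$ (i, l) - B $$ (i, l))\<^sup>2)"
    if "X \<in> carrier_mat r n" for X
    using A B that by (simp add: frobenius_norm_sq)
  have fopt: "(frobenius_norm (A * Xopt - B))\<^sup>2 = (\<Sum>i<N. \<Sum>l<n. (w i l)\<^sup>2)"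
    unfolding f[OF Xopt] by (simp add: w_index)

  let ?G = "{\<xi>. (\<forall>x. ip r x x / sqrt 2 \<le> sketch_quad \<xi> x) \<and>
      (\<Sum>k<r. \<Sum>l<n. (sketch_cross \<xi> w k l)\<^sup>2) \<le> \<epsilon> / 2 * (\<Sum>i<N. \<Sum>l<n. (w i l)\<^sup>2)}"
  let ?good = "{S. \<forall>X. least_squares_minimizer (S * A) (S * B) X \<longrightarrow>
      (frobenius_norm (A * X - B))\<^sup>2 \<le> (1 + \<epsilon>) * (frobenius_norm (A * Xopt - B))\<^sup>2}"
  \<comment> \<open>For a fixed outcome in \<open>?G\<close> the argument is deterministic and
    covers all minimizers of the sketched problem at once.\<close>
  have good: "hybrid_matrix s p ks \<xi> \<in> ?good" if \<xi>: "\<xi> \<in> ?G" for \<xi>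
  proof (intro CollectI allI impI)
    define S where "S = hybrid_matrix s p ks \<xi>"
    have Sc: "S \<in> carrier_mat s N"
      using p by (auto simp: S_def hybrid_matrix_def append_rows_def assms(21))
    have SA: "S * A \<in> carrier_mat s r" and SB: "S * B \<in> carrier_mat s n" using Sc A B by auto
    fix X assume "least_squares_minimizer (hybrid_matrix s p ks \<xi> * A) (hybrid_matrix s p ks \<xi> * B) X"
    then have X: "least_squares_minimizer (S * A) (S * B) X" by (simp add: S_def)
    have Xc: "X \<in> carrier_mat r n"
      using X A B by (auto simp: least_squares_minimizer_def is_arg_min_def)
    define Y where "Y = X - Xopt"
    have Y: "Y \<in> carrier_mat r n" using Xc Xopt unfolding Y_def by auto
    define Z where "Z = R * Y"
    have Z: "Z \<in> carrier_mat r n" using R Y by (simp add: Z_def)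
    have AY: "A * Y = U * Z" unfolding R(2) Z_def by (rule assoc_mult_mat[OF U R(1) Y])
    define z where "z k l = Z $$ (k, l)" for k l
    define e where "e i l = ip r (u i) (\<lambda>k. z k l)" for i l
    have e_index: "(A * Y) $$ (i, l) = e i l" if "i < N" "l < n" for i l
      using that by (simp add: AY mult_mat_index[OF U Z] e_def ip_def u_def z_def)
    have AX: "A * X = A * Xopt + A * Y"
    proof -
      have "X = Xopt + Y" using Xc Xopt by (intro eq_matI) (auto simp: Y_def)
      then show ?thesis using mult_add_distrib_mat[OF A Xopt Y] by simp
    qed
    have residual: "(A * X) $$ (i, l) - B $$ (i, l) = e i l + w i l" if "i < N" "l < n" for i l
      using that A Y Xopt w_index[OF that] e_index[OF that] by (simp add: AX)
    have norm_e: "(\<Sum>i<N. \<Sum>l<n. (e i l)\<^sup>2) = (\<Sum>k<r. \<Sum>l<n. (z k l)\<^sup>2)"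
    proof -
      have "(\<Sum>i<N. \<Sum>l<n. (e i l)\<^sup>2) = (\<Sum>l<n. \<Sum>i<N. (ip r (u i) (\<lambda>k. z k l))\<^sup>2)"
        unfolding e_def by (rule sum.swap)
      also have "\<dots> = (\<Sum>l<n. \<Sum>k<r. (z k l)\<^sup>2)"
        by (simp add: sum_rows_sq) (simp add: ip_def power2_eq_square)
      finally show ?thesis by (simp only: sum.swap[of _ "{..<r}"])
    qed
    have E: "(frobenius_norm (A * X - B))\<^sup>2 = (\<Sum>k<r. \<Sum>l<n. (z k l)\<^sup>2) + (\<Sum>i<N. \<Sum>l<n. (w i l)\<^sup>2)"
    proof -
      have "(frobenius_norm (A * X - B))\<^sup>2 = (\<Sum>i<N. \<Sum>l<n. (e i l)\<^sup>2 + 2 * (e i l * w i l) + (w i l)\<^sup>2)"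
        unfolding f[OF Xc] by (intro sum.cong refl) (simp add: residual power2_sum)
      also have "\<dots> = (\<Sum>i<N. \<Sum>l<n. (e i l)\<^sup>2) + 2 * (\<Sum>i<N. \<Sum>l<n. e i l * w i l) + (\<Sum>i<N. \<Sum>l<n. (w i l)\<^sup>2)"
        by (simp add: sum.distrib sum_distrib_left)
      also have "(\<Sum>i<N. \<Sum>l<n. e i l * w i l) = 0"
        using optimal[OF Y] by (simp add: e_index)
      finally show ?thesis by (simp add: norm_e)
    qed
    define V where "V = A * X - B"
    have V: "V \<in> carrier_mat N n" unfolding V_def by (intro minus_carrier_mat B)
    have AYc: "A * Y \<in> carrier_mat N n" using A Y by simp
    \<comment> \<open>The sketched residual is \<open>S * V\<close>, where \<open>V\<close> has the
      entries \<open>e i l + w i l\<close>. Its pairing with \<open>S * (A * Y)\<close> vanishes by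
      the sketched normal equations, and \<open>hybrid_matrix_form\<close> rewrites that pairing in
      terms of \<open>ks\<close> and the draws.\<close>
    have "(\<Sum>l<n. (\<Sum>i\<in>set ks. e i l * (e i l + w i l))
        + (\<Sum>j<s'. c (\<xi> j) * (e (\<xi> j) l * (e (\<xi> j) l + w (\<xi> j) l)))) = 0"
    proof -
      have "(\<Sum>i<s. (S * (A * Y)) $$ (i, l) * (S * V) $$ (i, l))
          = (\<Sum>i\<in>set ks. e i l * (e i l + w i l))
            + (\<Sum>j<s'. c (\<xi> j) * (e (\<xi> j) l * (e (\<xi> j) l + w (\<xi> j) l)))" if l: "l < n" for l
      proof -
        have idx: "(A * Y) $$ (i, l) * V $$ (i, l) = e i l * (e i l + w i l)" if "i < N" for i
          using residual[OF that l] e_index[OF that l] that l A B Xc by (simp add: V_def)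
        have "(\<Sum>i<s. (S * (A * Y)) $$ (i, l) * (S * V) $$ (i, l))
            = (\<Sum>i\<in>set ks. (A * Y) $$ (i, l) * V $$ (i, l))
              + (\<Sum>j<s'. 1 / (real s' * residual_prob p ks (\<xi> j)) * ((A * Y) $$ (\<xi> j, l) * V $$ (\<xi> j, l)))"
          unfolding assms(21)
          by (rule hybrid_matrix_form[OF p ks q0 AYc V l]) (simp add: S_def assms(21))
        also have "(\<Sum>i\<in>set ks. (A * Y) $$ (i, l) * V $$ (i, l)) = (\<Sum>i\<in>set ks. e i l * (e i l + w i l))"
          using ks idx by (intro sum.cong) auto
        also have "(\<Sum>j<s'. 1 / (real s' * residual_prob p ks (\<xi> j)) * ((A * Y) $$ (\<xi> j, l) * V $$ (\<xi> j, l)))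
            = (\<Sum>j<s'. c (\<xi> j) * (e (\<xi> j) l * (e (\<xi> j) l + w (\<xi> j) l)))"
        proof (intro sum.cong refl)
          fix j
          show "1 / (real s' * residual_prob p ks (\<xi> j)) * ((A * Y) $$ (\<xi> j, l) * V $$ (\<xi> j, l))
              = c (\<xi> j) * (e (\<xi> j) l * (e (\<xi> j) l + w (\<xi> j) l))"
          proof (cases "\<xi> j < N")
            case True
            then show ?thesis by (simp add: idx c_def pmf_q)
          next
            case False
            then have "residual_prob p ks (\<xi> j) = 0" using p by (simp add: residual_prob_def)
            then show ?thesis by (simp add: c_def pmf_q)
          qed
        qed
        finally show ?thesis .
      qed
      moreover have "(\<Sum>i<s. \<Sum>l<n. (S * (A * Y)) $$ (i, l) * (S * V) $$ (i, l)) = 0"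
      proof -
        have "S * V = S * A * X - S * B"
          using mult_minus_distrib_mat[OF Sc _ B] Sc A Xc by (simp add: V_def)
        then have "(S * V) $$ (i, l) = (S * A * X) $$ (i, l) - (S * B) $$ (i, l)" if "i < s" "l < n" for i l
          using that SA SB Xc Sc B by simp
        moreover have "S * (A * Y) = S * A * Y" using Sc A Y by simp
        ultimately show ?thesis using normal_equations[OF SA SB X Y] by simp
      qed
      ultimately show ?thesis by (simp add: sum.swap[of _ "{..<n}" "{..<s}"])
    qed
    then have "(\<Sum>k<r. \<Sum>l<n. (z k l)\<^sup>2) \<le> 2 * (\<Sum>k<r. \<Sum>l<n. (sketch_cross \<xi> w k l)\<^sup>2)"
      using \<xi> unfolding e_def by (intro sketch_solution_le) auto
    also have "\<dots> \<le> \<epsilon> * (\<Sum>i<N. \<Sum>l<n. (w i l)\<^sup>2)" using \<xi> by simp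
    finally show "(frobenius_norm (A * X - B))\<^sup>2 \<le> (1 + \<epsilon>) * (frobenius_norm (A * Xopt - B))\<^sup>2"
      unfolding E fopt by (simp add: distrib_right)
  qed

  have "1 - \<delta> \<le> measure_pmf.prob sample ?G"
    using s'_ge w_orth by (intro sample_good[OF assms(15,17,19)]) (auto simp: \<kappa>_def)
  also have "\<dots> \<le> measure_pmf.prob sample (hybrid_matrix s p ks -` ?good)"
    using good by (intro measure_pmf.finite_measure_mono) auto
  also have "\<dots> = measure_pmf.prob (hybrid_sample s p ks) ?good"
    by (simp add: hybrid_sample_def assms(21))
  finally show ?thesis .
qed

end
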